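(* Let $M$ be a hypercomplex subspace of $A$, let $\Omega\subseteq M$ be open and let $f:\Omega\to A$ be of class $\mathcal C^1$. If $A$ is not associative, assume that $f$ and $xf$ are $M$-admissible. Then $f$ is locally slice-regular on $\Omega$ if and only if for each $y\in\Omega$ there exist an open neighbourhood $\Omega_y\subseteq\Omega$ of $y$ and a slice-regular function $g_y$ on the symmetric completion $\widetilde{\Omega_y}=\bigcup_{x\in\Omega_y}\mathbb S_x$ that extends the restriction $f|_{\Omega_y}$.
   Context: $A$ is a finite-dimensional real alternative algebra with unity $1\ne0$ (the associator $(x,y,z)=(xy)z-x(yz)$ is alternating), $\mathbb R$ is identified with $\mathbb R\cdot 1$, and $A$ is a *-algebra with real linear anti-involution $x\mapsto x^c$, $(xy)^c=y^cx^c$, $x^c=x$ for $x\in\mathbb R$. Put $t(x)=x+x^c$, $n(x)=xx^c$, $\mathbb S_A=\{J\in A: t(J)=0,\ n(J)=1\}\neq\emptyset$, $\mathbb C_J=\mathrm{span}(1,J)$, $Q_A=\bigcup_{J\in\mathbb S_A}\mathbb C_J$; for $x=\alpha+\beta J\in Q_A$ ($\alpha,\beta\in\mathbb R$, $J\in\mathbb S_A$) put $\mathbb S_x=\alpha+\beta\,\mathbb S_A$. A hypercomplex subspace is a real vector subspace $M$ of $A$ with $\mathbb R\subset M\subset Q_A$ and $\dim(M)>2$; $m=\dim(M)-1$, $S=M\cap\mathbb S_A$. On $M$, $\langle x,y\rangle=\frac12t(xy^c)$ is a scalar product. $\mathcal B=(v_0=1,v_1,\dots,v_m)$ is an orthonormal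 basis of $M$, $x=\sum_{i=0}^mx_iv_i$, $\partial_i$ is the partial derivative w.r.t. $x_i$ of $A$-valued functions (componentwise), $\overline\partial_{\mathcal B}=\frac12(\partial_0+\sum_{i=1}^mv_i\partial_i)$. A $\mathcal C^1$ function $f:\Omega\to A$ is $M$-admissible if $f(x),\overline\partial_{\mathcal B}f(x)\in M$ for all $x\in\Omega$. $xf$ denotes the pointwise product $x\mapsto xf(x)$. Slice-regular functions: let $D\subseteq\mathbb C$ be open and conjugation-invariant, $\Omega_D=\{\alpha+J\beta:\alpha+i\beta\in D,\ J\in\mathbb S_A\}$. A stem function is $F=F_1+\imath F_2:D\to A\otimes_{\mathbb R}\mathbb C$ ($\imath^2=-1$) with $F(\overline z)=\overline{F(z)}$, where $\overline{a+\imath b}=a-\imath b$; it induces the slice function $\mathcal I(F):\Omega_D\to A$, $\alpha+J\beta\mapsto F_1(\alpha+i\beta)+JF_2(\alpha+i\beta)$, which is slice-regular if $F$ is holomorphic w.r.t. left multiplication by $\imath$. Local slice-regularity: $f\in\mathcal C^1(\Omega)$, $\Omega\subseteq M$ open, is locally slice-regular if (i) for every $I\in S$ with $\Omega_I:=\Omega\cap\mathbb C_I\ne\emptyset$, the restriction $f|_{\Omega_I}:\Omega_I\to A$ is holomorphic w.r.t. the complex structures given by left multiplication by $I$; and (ii) the functions $\overline\partial_{\mathcal B}f$ and $\overline\partial_{\mathcal B}(xf)$ are locally constant on $\mathbb S_y\cap\Omega$ for every $y\in\Omega$. *)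

theory Defs
  imports "HOL-Analysis.Analysis"
begin

(* The euclidean_space structure only supplies finite dimension and the canonical topology;
   its inner product and norm are not related to the multiplication.
   The three alt axioms say that the trilinear associator vanishes whenever two of its
   arguments coincide. *)

class alternative_star_algebra = euclidean_space + times + zero_neq_one +
  fixes star :: "'a \<Rightarrow> 'a"  ("_\<^sup>c" [1000] 999)
  assumes times_add_left: "(x + y) * z = x * z + y * z"
    and times_add_right: "x * (y + z) = x * y + x * z"
    and times_scaleR_left: "(r *\<^sub>R x) * y = r *\<^sub>R (x * y)"
    and times_scaleR_right: "x * (r *\<^sub>R y) = r *\<^sub>R (x * y)"
    and one_times: "1 * x = x"
    and times_one: "x * 1 = x"
    and alt_left: "(x * x) * y = x * (x * y)"
    and alt_flexible: "(x * y) * x = x * (y * x)"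
    and alt_right: "(y * x) * x = y * (x * x)"
    and star_add: "star (x + y) = star x + star y"
    and star_scaleR: "star (r *\<^sub>R x) = r *\<^sub>R star x"
    and star_star: "star (star x) = x"
    and star_times: "star (x * y) = star y * star x"
    and star_real: "star (r *\<^sub>R 1) = r *\<^sub>R 1"

definition tr :: "'a::alternative_star_algebra \<Rightarrow> 'a"
  where "tr x = x + x\<^sup>c"

definition nm :: "'a::alternative_star_algebra \<Rightarrow> 'a"
  where "nm x = x * x\<^sup>c"

definition imag_units :: "'a::alternative_star_algebra set"
  where "imag_units = {J. tr J = 0 \<and> nm J = 1}"

definition slice_plane :: "'a::alternative_star_algebra \<Rightarrow> 'a set"
  where "slice_plane J = span {1, J}"

definition quadratic_cone :: "'a::alternative_star_algebra set"
  where "quadratic_cone = (\<Union>J\<in>imag_units. slice_plane J)"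

definition slice_emb :: "'a::alternative_star_algebra \<Rightarrow> complex \<Rightarrow> 'a"
  where "slice_emb J z = Re z *\<^sub>R 1 + Im z *\<^sub>R J"

(* The set does not depend on the representation of x: alpha is unique, and beta is unique up
   to sign, while imag_units is closed under negation. *)

definition sphere_of :: "'a::alternative_star_algebra \<Rightarrow> 'a set"
  where "sphere_of x =
    {\<alpha> *\<^sub>R 1 + \<beta> *\<^sub>R K | \<alpha> \<beta> K. K \<in> imag_units \<and> (\<exists>J\<in>imag_units. x = \<alpha> *\<^sub>R 1 + \<beta> *\<^sub>R J)}"

definition sym_completion :: "'a::alternative_star_algebra set \<Rightarrow> 'a set"
  where "sym_completion U = (\<Union>x\<in>U. sphere_of x)"

definition hypercomplex_subspace :: "'a::alternative_star_algebra set \<Rightarrow> bool"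
  where "hypercomplex_subspace M \<longleftrightarrow>
    subspace M \<and> range (\<lambda>r. r *\<^sub>R 1) \<subseteq> M \<and> M \<subseteq> quadratic_cone \<and> dim M > 2"

(* A-valued; on a hypercomplex subspace the values are real multiples of 1. *)

definition hc_inner :: "'a::alternative_star_algebra \<Rightarrow> 'a \<Rightarrow> 'a"
  where "hc_inner x y = (1/2) *\<^sub>R tr (x * y\<^sup>c)"

definition hc_orthonormal_basis :: "'a::alternative_star_algebra set \<Rightarrow> (nat \<Rightarrow> 'a) \<Rightarrow> bool"
  where "hc_orthonormal_basis M v \<longleftrightarrow>
    v 0 = 1 \<and> inj_on v {0..dim M - 1} \<and> independent (v ` {0..dim M - 1}) \<and>
    span (v ` {0..dim M - 1}) = M \<and>
    (\<forall>i\<in>{0..dim M - 1}. \<forall>j\<in>{0..dim M - 1}. hc_inner (v i) (v j) = (if i = j then 1 else 0))"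

(* For a set open in a subspace M, only the values of f' x on M are determined by f. *)

definition C1_on :: "'a::euclidean_space set \<Rightarrow> ('a \<Rightarrow> 'b::real_normed_vector) \<Rightarrow> bool"
  where "C1_on \<Omega> f \<longleftrightarrow>
    (\<exists>f' :: 'a \<Rightarrow> 'a \<Rightarrow>\<^sub>L 'b. continuous_on \<Omega> f' \<and>
       (\<forall>x\<in>\<Omega>. (f has_derivative blinfun_apply (f' x)) (at x within \<Omega>)))"

definition partial :: "'a::real_normed_vector \<Rightarrow> ('a \<Rightarrow> 'b::real_normed_vector) \<Rightarrow> 'a \<Rightarrow> 'b"
  where "partial u f x = vector_derivative (\<lambda>t. f (x + t *\<^sub>R u)) (at 0)"

definition dbar :: "'a::alternative_star_algebra set \<Rightarrow> (nat \<Rightarrow> 'a) \<Rightarrow> ('a \<Rightarrow> 'a) \<Rightarrow> 'a \<Rightarrow> 'a"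
  where "dbar M v f x =
    (1/2) *\<^sub>R (partial (v 0) f x + (\<Sum>i = 1..dim M - 1. v i * partial (v i) f x))"

definition admissible ::
  "'a::alternative_star_algebra set \<Rightarrow> (nat \<Rightarrow> 'a) \<Rightarrow> 'a set \<Rightarrow> ('a \<Rightarrow> 'a) \<Rightarrow> bool"
  where "admissible M v \<Omega> f \<longleftrightarrow> C1_on \<Omega> f \<and> (\<forall>x\<in>\<Omega>. f x \<in> M \<and> dbar M v f x \<in> M)"

(* Holomorphy on an open D with respect to the complex structure J on the target. *)

definition holomorphic_wrt ::
  "('b::real_normed_vector \<Rightarrow> 'b) \<Rightarrow> complex set \<Rightarrow> (complex \<Rightarrow> 'b) \<Rightarrow> bool"
  where "holomorphic_wrt J D f \<longleftrightarrow>
    (\<forall>z\<in>D. \<exists>f'. (f has_derivative f') (at z) \<and> (\<forall>h. f' (\<i> * h) = J (f' h)))"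

(* The complexification of A is represented by pairs: (a, b) stands for a + imath b. *)

definition imath_mult :: "'a \<times> 'a \<Rightarrow> 'a \<times> 'a::real_vector"
  where "imath_mult w = (- snd w, fst w)"

definition compl_conj :: "'a \<times> 'a \<Rightarrow> 'a \<times> 'a::real_vector"
  where "compl_conj w = (fst w, - snd w)"

definition stem_function :: "complex set \<Rightarrow> (complex \<Rightarrow> 'a \<times> 'a::real_vector) \<Rightarrow> bool"
  where "stem_function D F \<longleftrightarrow> (\<forall>z\<in>D. F (cnj z) = compl_conj (F z))"

definition circularization :: "complex set \<Rightarrow> 'a::alternative_star_algebra set"
  where "circularization D = {slice_emb J z | J z. J \<in> imag_units \<and> z \<in> D}"

definition induces ::
  "complex set \<Rightarrow> (complex \<Rightarrow> 'a \<times> 'a::alternative_star_algebra) \<Rightarrow> ('a \<Rightarrow> 'a) \<Rightarrow> bool"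
  where "induces D F g \<longleftrightarrow>
    (\<forall>z\<in>D. \<forall>J\<in>imag_units. g (slice_emb J z) = fst (F z) + J * snd (F z))"

definition slice_regular_on :: "'a::alternative_star_algebra set \<Rightarrow> ('a \<Rightarrow> 'a) \<Rightarrow> bool"
  where "slice_regular_on U g \<longleftrightarrow>
    (\<exists>D F. open D \<and> cnj ` D = D \<and> circularization D = U \<and>
       stem_function D F \<and> holomorphic_wrt imath_mult D F \<and> induces D F g)"

definition locally_constant_on :: "'a::topological_space set \<Rightarrow> ('a \<Rightarrow> 'b) \<Rightarrow> bool"
  where "locally_constant_on T g \<longleftrightarrow>
    (\<forall>x\<in>T. \<exists>U. openin (top_of_set T) U \<and> x \<in> U \<and> g constant_on U)"

(* The restriction of f to the slice of I is read in the coordinate slice_emb I. *)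

definition locally_slice_regular ::
  "'a::alternative_star_algebra set \<Rightarrow> (nat \<Rightarrow> 'a) \<Rightarrow> 'a set \<Rightarrow> ('a \<Rightarrow> 'a) \<Rightarrow> bool"
  where "locally_slice_regular M v \<Omega> f \<longleftrightarrow>
    C1_on \<Omega> f \<and>
    (\<forall>I \<in> M \<inter> imag_units. \<Omega> \<inter> slice_plane I \<noteq> {} \<longrightarrow>
       holomorphic_wrt (\<lambda>a. I * a) (slice_emb I -` \<Omega>) (f \<circ> slice_emb I)) \<and>
    (\<forall>y\<in>\<Omega>. locally_constant_on (sphere_of y \<inter> \<Omega>) (dbar M v f) \<and>
            locally_constant_on (sphere_of y \<inter> \<Omega>) (dbar M v (\<lambda>x. x * f x)))"

end

theory Submission
  imports Defs
begin

text \<open>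
  Write \<open>x = \<alpha> + \<beta> J\<close>, and let \<open>f\<close> be holomorphic on the slices. Pure elements of \<open>M\<close> satisfy the
  Clifford relations, so left alternativity alone gives \<open>2 dbar (x f) = 2 x\<^sup>c dbar f - (m - 1) f\<close>.
  If \<open>dbar f\<close> and \<open>dbar (x f)\<close> are constant on a connected part of a sphere, then, as \<open>m \<ge> 2\<close>, there
  \<open>f\<close> is an affine function \<open>p + J q\<close> of \<open>J\<close>; its coefficients are the components of a stem function,
  and they are recovered from the holomorphic restrictions of \<open>f\<close> to two slices. Conversely, the
  chain rule shows that \<open>f = F\<^sub>1 + J F\<^sub>2\<close> has \<open>2 dbar f = - (m - 1) F\<^sub>2 / \<beta>\<close>, which depends on \<open>\<alpha>\<close> and
  \<open>\<beta>\<close> only, and by the identity the same holds for \<open>dbar (x f)\<close>.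
\<close>

section \<open>Alternative star-algebras\<close>

text \<open>Without associativity only \<open>x * (x * a) = (x * x) * a\<close> and its polarisation
  may be used, so products stay nested to the right, and the only left multiplications inverted are
  those by nonzero pure elements of \<open>M\<close>, whose squares are negative reals. The
  assumptions on \<open>f\<close> are local, whereas affinity in J needs constancy along a connected
  set of units. The neighbourhood found for y is therefore a product: all \<alpha> + \<beta> J with
  \<alpha> + i \<beta> in a disc W and J in one connected set T of units. Every sphere that it
  meets, it meets in an image of T, and a single pair (F_1, F_2) serves all of it. Around a real
  point T is the whole sphere of units and W is invariant under conjugation, which makes the parity
  of F automatic; otherwise T is a cap around the unit of y, W avoids the real axis and parity is
  imposed by reflection. The condition m \<ge> 2 acts twice: it permits division by m - 1, and it
  makes the sphere of units connected.\<close>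

lemma bounded_bilinear_times: "bounded_bilinear ((*) :: 'a::alternative_star_algebra \<Rightarrow> 'a \<Rightarrow> 'a)"
  unfolding bilinear_conv_bounded_bilinear[symmetric]
  by (simp add: bilinear_def linear_iff times_add_left times_add_right
      times_scaleR_left times_scaleR_right)

interpretation alg: bounded_bilinear "(*) :: 'a::alternative_star_algebra \<Rightarrow> 'a \<Rightarrow> 'a"
  by (rule bounded_bilinear_times)

lemmas alg_simps = alg.add_left alg.add_right alg.diff_left alg.diff_right
  alg.minus_left alg.minus_right alg.scaleR_left alg.scaleR_right one_times times_one

lemma star_minus: "star (- x) = - star (x :: 'a::alternative_star_algebra)"
  using star_scaleR[of "-1" x] by simp

lemma star_one [simp]: "star (1::'a::alternative_star_algebra) = 1"
  using star_real[of 1, where 'a='a] by simp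

text \<open>Left alternativity at x + y, minus its instances at x and y. It carries identities for x
  * y + y * x over to iterated left multiplications of \<open>a\<close>.\<close>

lemma alt_left_polar:
  fixes x y a :: "'a::alternative_star_algebra"
  shows "x * (y * a) + y * (x * a) = (x * y + y * x) * a"
  using alt_left[of "x + y" a] alt_left[of x a] alt_left[of y a]
  by (simp add: alg_simps algebra_simps)

text \<open>Left alternativity turns \<open>u * (u * a)\<close> into \<open>r *\<^sub>R a\<close>.
  This replaces division by \<open>u\<close>.\<close>

lemma mult_left_cancel_real_square:
  fixes u a :: "'a::alternative_star_algebra"
  assumes "u * u = r *\<^sub>R 1" "r \<noteq> 0" "u * a = 0"
  shows "a = 0"
  using alt_left[of u a] assms by (simp add: alg_simps alg.zero_right)

lemma imag_unitsD:
  fixes J :: "'a::alternative_star_algebra"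
  assumes "J \<in> imag_units"
  shows "star J = - J" "J * J = - 1" "J * (J * a) = - a"
proof -
  show 1: "star J = - J"
    using assms by (simp add: imag_units_def tr_def eq_neg_iff_add_eq_0 add.commute)
  show 2: "J * J = - 1"
    using assms 1 by (simp add: imag_units_def nm_def alg_simps) (metis minus_minus)
  show "J * (J * a) = - a"
    using alt_left[of J a] 2 by (simp add: alg_simps)
qed

lemma imag_units_iff:
  "(J :: 'a::alternative_star_algebra) \<in> imag_units \<longleftrightarrow> star J = - J \<and> J * J = - 1"
  by (rule iffI, blast intro: imag_unitsD, simp add: imag_units_def tr_def nm_def alg_simps)

lemma imag_units_minus [simp]:
  "- (J :: 'a::alternative_star_algebra) \<in> imag_units \<longleftrightarrow> J \<in> imag_units"
  by (simp add: imag_units_iff star_minus alg_simps) (metis minus_minus)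

text \<open>The values of \<open>hc_inner\<close> are real multiples of 1 only on a hypercomplex subspace; elsewhere
  this is the coefficient of their euclidean projection to the real line.\<close>

definition hc_ip :: "'a::alternative_star_algebra \<Rightarrow> 'a \<Rightarrow> real"
  where "hc_ip x y = (hc_inner x y \<bullet> 1) / (1 \<bullet> (1::'a))"

lemma hc_inner_eq: "hc_inner x y = (1/2) *\<^sub>R (x * star y + y * star x)"
  by (simp add: hc_inner_def tr_def star_times star_star)

lemma hc_inner_commute: "hc_inner x y = hc_inner y x"
  by (simp add: hc_inner_eq add.commute)

lemma hc_ip_commute: "hc_ip x y = hc_ip y x"
  by (simp add: hc_ip_def hc_inner_commute)

lemma bounded_bilinear_hc_ip: "bounded_bilinear hc_ip"
  unfolding bilinear_conv_bounded_bilinear[symmetric]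
  by (simp add: bilinear_def linear_iff hc_ip_def hc_inner_eq alg_simps star_add star_scaleR
      inner_add_left add_divide_distrib algebra_simps)

interpretation ip: bounded_bilinear hc_ip
  by (rule bounded_bilinear_hc_ip)

lemma hc_ip_real: "hc_inner x y = r *\<^sub>R 1 \<Longrightarrow> hc_ip x y = r"
  by (simp add: hc_ip_def)

section \<open>Real and imaginary parts; slice coordinates\<close>

definition re_part :: "'a::alternative_star_algebra \<Rightarrow> real"
  where "re_part x = hc_ip x 1"

definition im_part :: "'a::alternative_star_algebra \<Rightarrow> 'a"
  where "im_part x = x - re_part x *\<^sub>R 1"

text \<open>On the quadratic cone this is the modulus of \<beta> in \<alpha> + \<beta> J. Elsewhere
  the radicand may be negative; \<open>sqrt\<close> is an odd function on the reals, so
  \<open>im_abs\<close> is continuous on the whole space.\<close>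

definition im_abs :: "'a::alternative_star_algebra \<Rightarrow> real"
  where "im_abs x = sqrt (hc_ip (im_part x) (im_part x))"

lemma bounded_linear_re_part: "bounded_linear re_part"
  unfolding re_part_def[abs_def] by (rule ip.bounded_linear_left)

lemma bounded_linear_im_part: "bounded_linear im_part"
  unfolding im_part_def[abs_def]
  by (intro bounded_linear_sub bounded_linear_ident
      bounded_linear_compose[OF bounded_linear_scaleR_left bounded_linear_re_part])

lemma continuous_on_im_abs: "continuous_on S im_abs"
  unfolding im_abs_def[abs_def]
  by (intro continuous_intros ip.continuous_on bounded_linear.continuous_on[OF bounded_linear_im_part])

lemma re_im_split: "re_part x *\<^sub>R 1 + im_part x = x"
  by (simp add: im_part_def)

lemma hc_ip_imag_unit:
  assumes "J \<in> imag_units"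
  shows "hc_ip J J = 1" "hc_ip J 1 = 0" "hc_ip 1 J = 0"
  using assms by (auto intro!: hc_ip_real simp: hc_inner_eq imag_unitsD alg_simps
      simp flip: scaleR_add_left)

lemma hc_ip_one: "hc_ip 1 1 = 1"
  by (rule hc_ip_real) (simp add: hc_inner_eq alg_simps flip: scaleR_add_left)

lemma slice_emb_parts:
  assumes "J \<in> imag_units"
  shows "re_part (slice_emb J z) = Re z" "im_part (slice_emb J z) = Im z *\<^sub>R J"
    "im_abs (slice_emb J z) = \<bar>Im z\<bar>"
proof -
  show 1: "re_part (slice_emb J z) = Re z"
    by (simp add: re_part_def slice_emb_def ip.add_left ip.scaleR_left assms hc_ip_imag_unit hc_ip_one)
  show 2: "im_part (slice_emb J z) = Im z *\<^sub>R J"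
    by (simp add: im_part_def 1) (simp add: slice_emb_def)
  show "im_abs (slice_emb J z) = \<bar>Im z\<bar>"
    by (simp add: im_abs_def 2 ip.scaleR_left ip.scaleR_right hc_ip_imag_unit assms
        flip: power2_eq_square)
qed

text \<open>Comparing real and imaginary parts leaves only the exchange of (J, z) for (- J,
  \<open>cnj z\<close>) and, on the real axis, an arbitrary unit. These are the ambiguities that the
  parity of a stem function has to absorb.\<close>

lemma slice_emb_eq_iff:
  assumes "J \<in> imag_units" "K \<in> imag_units" "slice_emb J z = slice_emb K w"
  shows "w = z \<and> (Im z = 0 \<or> K = J) \<or> w = cnj z \<and> K = - J"
proof -
  have re: "Re z = Re w" and im: "Im z *\<^sub>R J = Im w *\<^sub>R K" and ab: "\<bar>Im z\<bar> = \<bar>Im w\<bar>"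
    using assms by (metis slice_emb_parts)+
  consider "Im w = Im z" | "Im w = - Im z" "Im z \<noteq> 0" using ab by linarith
  then show ?thesis
  proof cases
    case 1
    then have "Im z = 0 \<or> K = J" using im by auto
    then show ?thesis using re 1 by (auto simp: complex_eq_iff)
  next
    case 2
    then have "Im z *\<^sub>R (J + K) = 0" using im by (simp add: scaleR_add_right)
    then have "K = - J" using 2 by (simp add: add_eq_0_iff)
    then show ?thesis using re 2 by (auto simp: complex_eq_iff)
  qed
qed

lemma slice_emb_minus: "slice_emb (- J) z = slice_emb J (cnj z)"
  by (simp add: slice_emb_def)

lemma bounded_linear_slice_emb: "bounded_linear (slice_emb J)"
  unfolding slice_emb_def[abs_def]
  by (intro bounded_linear_add bounded_linear_compose[OF bounded_linear_scaleR_left bounded_linear_Re]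
      bounded_linear_compose[OF bounded_linear_scaleR_left bounded_linear_Im])

lemma slice_plane_eq: "slice_plane J = range (slice_emb J)"
proof -
  have "x \<in> span {1, J} \<longleftrightarrow> (\<exists>z. x = slice_emb J z)" for x
  proof
    assume "x \<in> span {1, J}"
    then obtain a b where "x = a *\<^sub>R 1 + b *\<^sub>R J"
      by (auto simp: span_insert algebra_simps)
    then have "x = slice_emb J (Complex a b)" by (simp add: slice_emb_def)
    then show "\<exists>z. x = slice_emb J z" ..
  next
    show "\<exists>z. x = slice_emb J z \<Longrightarrow> x \<in> span {1, J}"
      unfolding slice_emb_def by (blast intro: span_add span_scale span_base)
  qed
  then show ?thesis by (auto simp: slice_plane_def)
qed

lemma sphere_of_slice_emb:
  assumes "J \<in> imag_units"
  shows "sphere_of (slice_emb J z) = {slice_emb K z | K. K \<in> imag_units}"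
proof safe
  fix x assume "x \<in> sphere_of (slice_emb J z)"
  then obtain \<alpha> \<beta> K L where *: "x = \<alpha> *\<^sub>R 1 + \<beta> *\<^sub>R K" "K \<in> imag_units" "L \<in> imag_units"
    "slice_emb J z = \<alpha> *\<^sub>R 1 + \<beta> *\<^sub>R L"
    by (auto simp: sphere_of_def)
  let ?w = "Complex \<alpha> \<beta>"
  have "slice_emb J z = slice_emb L ?w" using * by (simp add: slice_emb_def)
  from slice_emb_eq_iff[OF assms *(3) this] have "?w = z \<or> ?w = cnj z" by blast
  moreover have "x = slice_emb K ?w" using * by (simp add: slice_emb_def)
  ultimately have "x = slice_emb K z \<or> x = slice_emb (- K) z"
    by (auto simp: slice_emb_minus)
  then show "\<exists>K. x = slice_emb K z \<and> K \<in> imag_units"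
    using *(2) imag_units_minus by blast
next
  fix K :: 'a assume "K \<in> imag_units"
  then show "slice_emb K z \<in> sphere_of (slice_emb J z)"
    using assms by (auto simp: sphere_of_def slice_emb_def)
qed

section \<open>Hypercomplex subspaces\<close>

locale hypercomplex_frame =
  fixes M :: "'a::alternative_star_algebra set" and v :: "nat \<Rightarrow> 'a"
  assumes hypercomplex: "hypercomplex_subspace M" and orthonormal: "hc_orthonormal_basis M v"
begin

abbreviation m :: nat where "m \<equiv> dim M - 1"

abbreviation units :: "'a set" where "units \<equiv> M \<inter> imag_units"

lemma m_ge_2: "m \<ge> 2"
  using hypercomplex unfolding hypercomplex_subspace_def by linarith

lemma subspace_M: "subspace M"
  using hypercomplex by (simp add: hypercomplex_subspace_def)

lemmas M_add = subspace_add[OF subspace_M] and M_diff = subspace_diff[OF subspace_M]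
  and M_scale = subspace_scale[OF subspace_M] and M_neg = subspace_neg[OF subspace_M]

lemma one_in_M: "1 \<in> M"
  using hypercomplex scaleR_one[of "1::'a"] unfolding hypercomplex_subspace_def by (metis rangeI subsetD)

lemma slice_emb_in_M: "J \<in> M \<Longrightarrow> slice_emb J z \<in> M"
  by (simp add: slice_emb_def M_add M_scale one_in_M)

lemma M_slice:
  assumes "x \<in> M" obtains J z where "J \<in> imag_units" "x = slice_emb J z"
proof -
  have "x \<in> quadratic_cone" using assms hypercomplex by (auto simp: hypercomplex_subspace_def)
  then show ?thesis using that by (auto simp: quadratic_cone_def slice_plane_eq)
qed

lemma v_0: "v 0 = 1"
  using orthonormal by (simp add: hc_orthonormal_basis_def)

lemma v_in_M: "i \<le> m \<Longrightarrow> v i \<in> M"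
  using orthonormal span_superset[of "v ` {0..m}"] by (auto simp: hc_orthonormal_basis_def)

lemma hc_ip_v: "i \<le> m \<Longrightarrow> j \<le> m \<Longrightarrow> hc_ip (v i) (v j) = (if i = j then 1 else 0)"
  using orthonormal by (intro hc_ip_real) (simp add: hc_orthonormal_basis_def)

lemma star_M:
  assumes "x \<in> M"
  shows "star x = re_part x *\<^sub>R 1 - im_part x"
proof -
  obtain J z where "J \<in> imag_units" "x = slice_emb J z" using M_slice assms by blast
  then show ?thesis
    by (simp add: slice_emb_parts) (simp add: slice_emb_def star_add star_scaleR imag_unitsD)
qed

text \<open>An element of \<open>M\<close> lies in some slice plane, where \<open>x * star x\<close>
  is visibly real; polarising this quadratic form on the subspace \<open>M\<close> makes the mixed
  products real as well.\<close>

lemma hc_inner_M: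
  assumes "x \<in> M" "y \<in> M"
  shows "hc_inner x y = hc_ip x y *\<^sub>R 1"
proof -
  have sq: "\<exists>r. hc_inner x x = r *\<^sub>R 1" if xM: "x \<in> M" for x :: 'a
  proof -
    obtain J z where Jz: "J \<in> imag_units" "x = slice_emb J z" using M_slice xM by blast
    then have "x * star x = ((Re z)\<^sup>2 + (Im z)\<^sup>2) *\<^sub>R 1"
      by (simp add: slice_emb_def star_add star_scaleR alg_simps imag_unitsD
          power2_eq_square algebra_simps)
    then have "hc_inner x x = ((Re z)\<^sup>2 + (Im z)\<^sup>2) *\<^sub>R 1"
      by (simp only: hc_inner_eq scaleR_half_double)
    then show ?thesis ..
  qed
  obtain r s t where "hc_inner x x = r *\<^sub>R 1" "hc_inner y y = s *\<^sub>R 1"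
    "hc_inner (x + y) (x + y) = t *\<^sub>R 1"
    using sq assms M_add by metis
  moreover have "hc_inner x y =
      (1/2) *\<^sub>R (hc_inner (x + y) (x + y) - hc_inner x x - hc_inner y y)"
    by (simp add: hc_inner_eq star_add alg_simps algebra_simps flip: scaleR_add_left)
  ultimately have "hc_inner x y = ((t - r - s) / 2) *\<^sub>R 1"
    by (simp flip: scaleR_diff_left)
  then show ?thesis using hc_ip_real by metis
qed

lemma im_part_in_M: "x \<in> M \<Longrightarrow> im_part x \<in> M"
  by (simp add: im_part_def M_diff M_scale one_in_M)

lemma re_part_im_part [simp]: "re_part (im_part x) = 0"
  by (simp add: im_part_def re_part_def ip.diff_left ip.scaleR_left hc_ip_one)

lemma re_part_v: "1 \<le> i \<Longrightarrow> i \<le> m \<Longrightarrow> re_part (v i) = 0"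
  using hc_ip_v[of i 0] by (simp add: re_part_def v_0)

lemma re_part_one [simp]: "re_part 1 = 1"
  by (simp add: re_part_def hc_ip_one)

lemma im_part_eq_self: "re_part x = 0 \<Longrightarrow> im_part x = x"
  by (simp add: im_part_def)

text \<open>The Clifford relation: on pure elements the star is negation, so
  \<open>hc_inner x y\<close> is minus one half of the anticommutator.\<close>

lemma anticommutator:
  assumes "x \<in> M" "y \<in> M" "re_part x = 0" "re_part y = 0"
  shows "x * y + y * x = - (2 * hc_ip x y) *\<^sub>R 1"
proof -
  have "hc_inner x y = - ((1/2) *\<^sub>R (x * y + y * x))"
    using assms by (simp add: hc_inner_eq star_M im_part_eq_self alg_simps scaleR_diff_right
        scaleR_add_right)
  then have "x * y + y * x = (- 2) *\<^sub>R hc_inner x y" by simp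
  then show ?thesis by (simp add: hc_inner_M[OF assms(1,2)])
qed

lemma square_pure:
  assumes "x \<in> M" "re_part x = 0"
  shows "x * x = - hc_ip x x *\<^sub>R 1"
proof -
  have "2 *\<^sub>R (x * x) = 2 *\<^sub>R (- hc_ip x x *\<^sub>R 1)"
    using anticommutator[of x x] assms by (simp add: scaleR_2)
  then show ?thesis by (simp only: scaleR_cancel_left) simp
qed

text \<open>A pure \<open>J\<close> in \<open>M\<close> has square
  \<open>- hc_ip J J *\<^sub>R 1\<close>. Hence the units form the round sphere of dimension m - 1
  in the pure part of \<open>M\<close>, and their topology can be studied by scalar
  products.\<close>

lemma units_iff: "J \<in> units \<longleftrightarrow> J \<in> M \<and> re_part J = 0 \<and> hc_ip J J = 1"
proof
  show "J \<in> M \<and> re_part J = 0 \<and> hc_ip J J = 1" if "J \<in> units"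
    using that by (auto simp: hc_ip_imag_unit re_part_def)
  show "J \<in> units" if "J \<in> M \<and> re_part J = 0 \<and> hc_ip J J = 1"
    using that square_pure[of J] by (simp add: imag_units_iff star_M im_part_eq_self)
qed

lemma units_minus: "- J \<in> units \<longleftrightarrow> J \<in> units"
  using M_neg[of J] M_neg[of "- J"] by auto

lemma v_in_units: "1 \<le> i \<Longrightarrow> i \<le> m \<Longrightarrow> v i \<in> units"
  by (simp only: units_iff) (simp add: v_in_M re_part_v hc_ip_v)

lemma expansion:
  assumes "x \<in> M"
  shows "(\<Sum>i\<le>m. hc_ip x (v i) *\<^sub>R v i) = x"
proof -
  have "x \<in> span (v ` {0..m})"
    using assms orthonormal by (simp add: hc_orthonormal_basis_def)
  then show ?thesis
  proof (induction rule: span_induct_alt)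
    case base
    show ?case by (simp add: ip.zero_left)
  next
    case (step c b y)
    then obtain j where j: "j \<le> m" "b = v j" by auto
    have "(\<Sum>i\<le>m. hc_ip (v j) (v i) *\<^sub>R v i) = (\<Sum>i\<le>m. if i = j then v i else 0)"
      by (rule sum.cong) (use j hc_ip_v in auto)
    also have "\<dots> = v j" using j by simp
    finally have "(\<Sum>i\<le>m. hc_ip b (v i) *\<^sub>R v i) = b" using j by simp
    then have "c *\<^sub>R (\<Sum>i\<le>m. hc_ip b (v i) *\<^sub>R v i) + (\<Sum>i\<le>m. hc_ip y (v i) *\<^sub>R v i) = c *\<^sub>R b + y"
      using step by simp
    then show ?case
      by (simp add: ip.add_left ip.scaleR_left scaleR_add_left sum.distrib scaleR_sum_right)
  qed
qed

lemma im_part_expansion: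
  assumes "x \<in> M"
  shows "(\<Sum>i = 1..m. hc_ip x (v i) *\<^sub>R v i) = im_part x"
proof -
  have "hc_ip x (v 0) *\<^sub>R v 0 + (\<Sum>i = 1..m. hc_ip x (v i) *\<^sub>R v i) = x"
    using expansion[OF assms] by (simp add: atMost_atLeast0 sum.atLeast_Suc_atMost)
  then show ?thesis by (simp add: im_part_def re_part_def v_0 eq_diff_eq add.commute)
qed

lemma hc_ip_self:
  assumes "x \<in> M"
  shows "hc_ip x x = (\<Sum>i\<le>m. (hc_ip x (v i))\<^sup>2)"
  using arg_cong[OF expansion[OF assms], of "hc_ip x"]
  by (simp add: ip.sum_right ip.scaleR_right power2_eq_square)

lemma hc_ip_nonneg: "x \<in> M \<Longrightarrow> hc_ip x x \<ge> 0"
  by (simp add: hc_ip_self sum_nonneg)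

lemma hc_ip_eq_0_iff:
  assumes "x \<in> M" shows "hc_ip x x = 0 \<longleftrightarrow> x = 0"
proof
  assume "hc_ip x x = 0"
  then have "\<forall>i\<le>m. hc_ip x (v i) = 0"
    using hc_ip_self[OF assms] by (simp add: sum_nonneg_eq_0_iff)
  then show "x = 0" using expansion[OF assms] by simp
qed (simp add: ip.zero_left)

text \<open>The norm of the type is unrelated to \<open>hc_ip\<close>; this comparison lets
  neighbourhoods measured by \<open>hc_ip\<close> fit into open sets. Each coefficient in the
  expansion of x is at most \<open>sqrt (hc_ip x x)\<close>, and the summand 1 makes the constant
  positive.\<close>

lemma norm_le_hc_norm: "\<exists>C>0. \<forall>x\<in>M. norm x \<le> C * sqrt (hc_ip x x)"
proof (intro exI conjI ballI)
  let ?C = "1 + (\<Sum>i\<le>m. norm (v i))"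
  show "?C > 0" by (simp add: sum_nonneg add_pos_nonneg)
  fix x assume x: "x \<in> M"
  have *: "\<bar>hc_ip x (v i)\<bar> \<le> sqrt (hc_ip x x)" if "i \<le> m" for i
  proof -
    have "(hc_ip x (v i))\<^sup>2 \<le> hc_ip x x"
      unfolding hc_ip_self[OF x] using that by (intro member_le_sum) auto
    then show ?thesis using real_sqrt_le_mono by fastforce
  qed
  have "norm x \<le> (\<Sum>i\<le>m. norm (hc_ip x (v i) *\<^sub>R v i))"
    using expansion[OF x] norm_sum by metis
  also have "\<dots> \<le> (\<Sum>i\<le>m. sqrt (hc_ip x x) * norm (v i))"
    by (rule sum_mono) (auto intro!: mult_right_mono *)
  also have "\<dots> \<le> ?C * sqrt (hc_ip x x)"
    using hc_ip_nonneg[OF x] by (simp add: sum_distrib_left algebra_simps)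
  finally show "norm x \<le> ?C * sqrt (hc_ip x x)" .
qed

lemma im_abs_square: "x \<in> M \<Longrightarrow> (im_abs x)\<^sup>2 = hc_ip (im_part x) (im_part x)"
  by (simp add: im_abs_def hc_ip_nonneg im_part_in_M)

lemma im_abs_nonneg: "x \<in> M \<Longrightarrow> im_abs x \<ge> 0"
  by (simp add: im_abs_def hc_ip_nonneg im_part_in_M)

text \<open>For x in \<open>M\<close> this selects the slice coordinate in the closed upper
  half-plane. It is constant on each sphere and, unlike the unit J, continuous also at real
  points.\<close>

definition zeta :: "'a \<Rightarrow> complex" where "zeta x = Complex (re_part x) (im_abs x)"

lemma continuous_on_zeta: "continuous_on S zeta"
  unfolding zeta_def[abs_def] Complex_eq
  by (intro continuous_intros continuous_on_im_abs bounded_linear.continuous_on[OF bounded_linear_re_part])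

lemma M_slice_zeta:
  assumes "x \<in> M"
  obtains J where "J \<in> units" "x = slice_emb J (zeta x)"
    "im_abs x > 0 \<Longrightarrow> J = im_part x /\<^sub>R im_abs x"
proof (cases "im_abs x = 0")
  case True
  then have "im_part x = 0"
    using assms im_abs_square hc_ip_eq_0_iff im_part_in_M by fastforce
  \<comment> \<open>At a real point every unit serves; \<open>v 1\<close> is available since m \<ge>
    2.\<close>
  then have "x = slice_emb (v 1) (zeta x)"
    using True re_im_split[of x] by (simp add: slice_emb_def zeta_def)
  then show ?thesis using that[of "v 1"] v_in_units[of 1] m_ge_2 True by simp
next
  case False
  let ?J = "im_part x /\<^sub>R im_abs x"
  have "hc_ip ?J ?J = 1"
    using False im_abs_square[OF assms, symmetric]
    by (simp add: ip.scaleR_left ip.scaleR_right power2_eq_square field_simps)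
  moreover have "re_part ?J = 0"
    using re_part_im_part[of x] by (simp add: re_part_def ip.scaleR_left)
  ultimately have "?J \<in> units"
    unfolding units_iff by (simp add: assms M_scale im_part_in_M)
  moreover have "x = slice_emb ?J (zeta x)"
    using False re_im_split[of x] by (simp add: slice_emb_def zeta_def)
  ultimately show ?thesis using that by blast
qed

lemma zeta_slice_emb: "J \<in> imag_units \<Longrightarrow> zeta (slice_emb J z) = Complex (Re z) \<bar>Im z\<bar>"
  by (simp add: zeta_def slice_emb_parts)

section \<open>Geometry of the sphere of units\<close>

lemma hc_ip_units_le:
  assumes "J \<in> units" "K \<in> units" shows "hc_ip J K \<le> 1"
proof -
  have "J \<in> M" "K \<in> M" "hc_ip J J = 1" "hc_ip K K = 1"
    using assms units_iff by blast+
  then show ?thesis using hc_ip_nonneg[of "J - K"]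
    by (simp add: M_diff ip.diff_left ip.diff_right hc_ip_commute[of K J])
qed

text \<open>The vector J + K is nonzero, and its squared length is 2 + 2
  \<open>hc_ip J K\<close>.\<close>

lemma hc_ip_units_gt:
  assumes "J \<in> units" "K \<in> units" "J \<noteq> - K" shows "hc_ip J K > - 1"
proof -
  have "hc_ip (J + K) (J + K) \<noteq> 0" "hc_ip (J + K) (J + K) \<ge> 0"
    using hc_ip_eq_0_iff[of "J + K"] hc_ip_nonneg[of "J + K"] assms
    by (auto simp: M_add eq_neg_iff_add_eq_0)
  then show ?thesis using assms units_iff[of J] units_iff[of K]
    by (simp add: ip.add_left ip.add_right hc_ip_commute[of K J])
qed

text \<open>The segment from J to K misses the origin because its ends are not antipodal, so it can
  be projected radially to the sphere. The projection divides by a length at most 1, hence does not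
  lower a non-negative product with K; this keeps arcs towards the centre of a cap inside the
  cap.\<close>

lemma units_arc:
  assumes J: "J \<in> units" and K: "K \<in> units" and "J \<noteq> - K"
  obtains C where "connected C" "J \<in> C" "K \<in> C" "C \<subseteq> units"
    "\<And>L. L \<in> C \<Longrightarrow> hc_ip J K \<ge> 0 \<Longrightarrow> hc_ip L K \<ge> hc_ip J K"
proof -
  define c where "c = hc_ip J K"
  have c: "-1 < c" "c \<le> 1" using assms hc_ip_units_le hc_ip_units_gt by (auto simp: c_def)
  note JK = J[unfolded units_iff] K[unfolded units_iff]
  define p where "p t = (1 - t) *\<^sub>R J + t *\<^sub>R K" for t
  define q where "q t = hc_ip (p t) (p t)" for t
  define l where "l t = p t /\<^sub>R sqrt (q t)" for t
  \<comment> \<open>One polynomial in two forms: the first shows positivity inside the interval,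
    from c > -1; the second shows the bound 1, from c \<le> 1.\<close>
  have q: "q t = (1 - 2 * t)\<^sup>2 + 2 * t * (1 - t) * (1 + c)"
    "q t = 1 - 2 * t * (1 - t) * (1 - c)" for t
  proof -
    have "q t = (1 - t) * (1 - t) + 2 * t * (1 - t) * c + t * t"
      using JK by (simp add: q_def p_def ip.add_left ip.add_right ip.scaleR_left ip.scaleR_right
          c_def hc_ip_commute[of K J]) (simp add: algebra_simps)
    then show "q t = (1 - 2 * t)\<^sup>2 + 2 * t * (1 - t) * (1 + c)"
      "q t = 1 - 2 * t * (1 - t) * (1 - c)"
      by (simp_all add: power2_eq_square algebra_simps)
  qed
  have q01: "0 < q t" "q t \<le> 1" if "0 \<le> t" "t \<le> 1" for t
  proof -
    show "q t \<le> 1" using that c by (simp add: q(2))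
    show "0 < q t"
    proof (cases "t = 0 \<or> t = 1")
      case True then show ?thesis by (auto simp: q(2))
    next
      case False
      then have "0 < 2 * t * (1 - t) * (1 + c)" using that c by simp
      then show ?thesis by (simp add: q(1) add_nonneg_pos)
    qed
  qed
  show ?thesis
  proof
    show "connected (l ` {0..1})"
    proof (rule connected_continuous_image)
      have "continuous_on {0..1} q"
        unfolding q_def[abs_def] p_def by (intro ip.continuous_on continuous_intros)
      moreover have "sqrt (q t) \<noteq> 0" if "t \<in> {0..1}" for t
        using q01(1)[of t] that by simp
      ultimately show "continuous_on {0..1} l"
        unfolding l_def[abs_def] p_def by (intro continuous_intros) auto
    qed simp
    have "l 0 = J" "l 1 = K" by (simp_all add: l_def q(2)) (simp_all add: p_def)
    then show "J \<in> l ` {0..1}" "K \<in> l ` {0..1}" by (metis atLeastAtMost_iff image_eqI order_refl zero_le_one)+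
    show "l ` {0..1} \<subseteq> units"
    proof (rule image_subsetI)
      fix t :: real assume "t \<in> {0..1}"
      then have "q t > 0" using q01 by simp
      then have "hc_ip (l t) (l t) = 1"
        by (simp add: l_def ip.scaleR_left ip.scaleR_right flip: q_def)
           (simp add: field_simps)
      moreover have "re_part (l t) = 0"
        using JK by (simp add: re_part_def l_def p_def ip.add_left ip.scaleR_left)
      moreover have "l t \<in> M" using JK by (simp add: l_def p_def M_add M_scale)
      ultimately show "l t \<in> units" by (simp only: units_iff)
    qed
    fix L assume "L \<in> l ` {0..1}" and c0: "hc_ip J K \<ge> 0"
    then obtain t where t: "0 \<le> t" "t \<le> 1" "L = l t" by auto
    have "c \<le> c + t * (1 - c)" using t c by simp
    also have "\<dots> = (1 - t) * c + t" by (simp add: algebra_simps)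
    also have "\<dots> \<le> ((1 - t) * c + t) / sqrt (q t)"
      using q01[OF t(1,2)] t c0 by (simp add: pos_le_divide_eq c_def mult_left_le)
    also have "\<dots> = hc_ip L K"
      using JK by (simp add: t(3) l_def p_def ip.add_left ip.scaleR_left c_def divide_inverse)
    finally show "hc_ip L K \<ge> hc_ip J K" by (simp add: c_def)
  qed
qed

text \<open>Gram-Schmidt applied to \<open>v 1\<close> or \<open>v 2\<close>: being orthonormal,
  they cannot both be multiples of I.\<close>

lemma orthogonal_unit:
  assumes "I \<in> units"
  obtains K where "K \<in> units" "hc_ip K I = 0"
proof -
  have *: "\<exists>K\<in>units. hc_ip K I = 0" if "i \<in> {1..m}" "v i \<noteq> hc_ip (v i) I *\<^sub>R I" for i
  proof -
    let ?u = "v i - hc_ip (v i) I *\<^sub>R I"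
    note I = assms[unfolded units_iff]
    have u: "?u \<in> M" "re_part ?u = 0" "hc_ip ?u I = 0" "hc_ip ?u ?u \<noteq> 0"
      using that I v_in_M[of i] re_part_v[of i] hc_ip_eq_0_iff[of ?u]
      by (auto simp: M_diff M_scale re_part_def ip.diff_left ip.scaleR_left)
    have "hc_ip ?u ?u > 0" using u hc_ip_nonneg[of ?u] by simp
    then have "?u /\<^sub>R sqrt (hc_ip ?u ?u) \<in> units"
      unfolding units_iff using u(1,2)
      by (simp add: M_scale re_part_def ip.scaleR_left ip.scaleR_right) (simp add: field_simps)
    then show ?thesis using u(3) by (intro bexI) (auto simp: ip.scaleR_left)
  qed
  have "\<not> (v 1 = hc_ip (v 1) I *\<^sub>R I \<and> v 2 = hc_ip (v 2) I *\<^sub>R I)"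
  proof
    assume a: "v 1 = hc_ip (v 1) I *\<^sub>R I \<and> v 2 = hc_ip (v 2) I *\<^sub>R I"
    have "hc_ip (v 1) (v 2) = hc_ip (v 1) I * hc_ip (v 2) I"
      using a by (metis ip.scaleR_right real_scaleR_def mult.commute)
    moreover have "hc_ip (v 1) (v 2) = 0" "hc_ip (v 1) (v 1) = 1" "hc_ip (v 2) (v 2) = 1"
      using m_ge_2 by (simp_all add: hc_ip_v)
    ultimately show False using a by (metis mult_eq_0_iff scaleR_zero_left ip.zero_left zero_neq_one)
  qed
  then show ?thesis using * m_ge_2 that by (metis atLeastAtMost_iff le_refl one_le_numeral order_trans)
qed

end

section \<open>The Cauchy-Riemann operator\<close>

context hypercomplex_frame begin

lemma open_vimage_frame:
  assumes "openin (top_of_set M) \<Omega>" "continuous_on UNIV h" "range h \<subseteq> M"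
  shows "open (h -` \<Omega>)"
proof -
  obtain T where T: "open T" "\<Omega> = M \<inter> T" using assms(1) by (auto simp: openin_open)
  then have "h -` \<Omega> = h -` T" using assms(3) by auto
  then show ?thesis using T(1) assms(2) open_vimage by metis
qed

text \<open>A set open in \<open>M\<close> need not be open in the algebra, but its preimage under a
  continuous map into \<open>M\<close> is open, so the composite has an unrestricted
  derivative.\<close>

lemma has_derivative_along:
  assumes "openin (top_of_set M) \<Omega>" and "(f has_derivative f') (at (h t) within \<Omega>)"
    and "h t \<in> \<Omega>" and h: "\<And>t. (h has_derivative h') (at t)" and "range h \<subseteq> M"
  shows "((\<lambda>t. f (h t)) has_derivative (\<lambda>s. f' (h' s))) (at t)"
proof -
  let ?T = "h -` \<Omega>"
  have "continuous_on UNIV h" using h has_derivative_continuous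
    by (metis continuous_at_imp_continuous_on)
  then have "open ?T" using open_vimage_frame assms by blast
  have "((\<lambda>t. f (h t)) has_derivative (\<lambda>s. f' (h' s))) (at t within ?T)"
    by (rule has_derivative_in_compose[OF has_derivative_at_withinI[OF h]])
       (rule has_derivative_subset[OF assms(2)], auto)
  moreover have "at t within ?T = at t" using \<open>open ?T\<close> assms(3) by (intro at_within_open) auto
  ultimately show ?thesis by simp
qed

lemma partial_eq:
  assumes "openin (top_of_set M) \<Omega>" and f': "(f has_derivative f') (at x within \<Omega>)"
    and "x \<in> \<Omega>" and u: "u \<in> M"
  shows "partial u f x = f' u"
proof -
  have "x \<in> M" using assms openin_imp_subset by blast
  then have range: "range (\<lambda>t. x + t *\<^sub>R u) \<subseteq> M" using u M_add M_scale by blast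
  have line: "((\<lambda>t. x + t *\<^sub>R u) has_derivative (\<lambda>s. s *\<^sub>R u)) (at t)" for t
    by (auto intro!: derivative_eq_intros)
  have "((\<lambda>t. f (x + t *\<^sub>R u)) has_derivative (\<lambda>s. f' (s *\<^sub>R u))) (at 0)"
    by (rule has_derivative_along[OF assms(1) _ _ line range]) (simp_all add: f' \<open>x \<in> \<Omega>\<close>)
  moreover have "f' (s *\<^sub>R u) = s *\<^sub>R f' u" for s
    using has_derivative_linear[OF f'] by (simp add: linear_scale)
  ultimately have "((\<lambda>t. f (x + t *\<^sub>R u)) has_vector_derivative f' u) (at 0)"
    by (simp add: has_vector_derivative_def)
  then show ?thesis by (simp add: partial_def vector_derivative_at)
qed

lemma dbar_eq:
  assumes "openin (top_of_set M) \<Omega>" and "(f has_derivative f') (at x within \<Omega>)" and "x \<in> \<Omega>"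
  shows "2 *\<^sub>R dbar M v f x = f' 1 + (\<Sum>i = 1..m. v i * f' (v i))"
proof -
  have "partial (v i) f x = f' (v i)" if "i \<le> m" for i
    using partial_eq assms v_in_M that by blast
  from this[of 0] this show ?thesis by (simp add: dbar_def v_0)
qed

lemma has_derivative_slice:
  assumes "openin (top_of_set M) \<Omega>" and "(f has_derivative f') (at (slice_emb I z) within \<Omega>)"
    and "slice_emb I z \<in> \<Omega>" and "I \<in> M"
  shows "((f \<circ> slice_emb I) has_derivative (\<lambda>s. f' (slice_emb I s))) (at z)"
  unfolding comp_def
  by (rule has_derivative_along[where h = "slice_emb I", OF assms(1-3)])
     (use assms(4) slice_emb_in_M in
       \<open>auto intro: bounded_linear_imp_has_derivative bounded_linear_slice_emb\<close>)

text \<open>By polarised left alternativity \<open>v i\<close> passes the pure part of x with a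
  change of sign, which turns x into its conjugate at the cost of a real multiple of
  \<open>a\<close>.\<close>

lemma v_times_times:
  assumes "x \<in> M" "1 \<le> i" "i \<le> m"
  shows "v i * (x * a) = star x * (v i * a) - (2 * hc_ip x (v i)) *\<^sub>R a"
proof -
  let ?y = "im_part x"
  have ip: "hc_ip ?y (v i) = hc_ip x (v i)"
    using re_part_v[OF assms(2,3)]
    by (simp add: im_part_def re_part_def ip.diff_left ip.scaleR_left hc_ip_commute[of 1])
  have "v i * (?y * a) + ?y * (v i * a) = (v i * ?y + ?y * v i) * a"
    by (rule alt_left_polar)
  also have "v i * ?y + ?y * v i = - (2 * hc_ip x (v i)) *\<^sub>R 1"
    using anticommutator[of ?y "v i"] assms ip
    by (simp add: im_part_in_M v_in_M re_part_v add.commute)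
  finally have "v i * (?y * a) = - (?y * (v i * a)) - (2 * hc_ip x (v i)) *\<^sub>R a"
    by (simp add: alg_simps eq_neg_iff_add_eq_0 algebra_simps)
  moreover have "x * a = re_part x *\<^sub>R a + ?y * a"
    using arg_cong[OF re_im_split[of x, symmetric], of "\<lambda>x. x * a"] by (simp add: alg_simps)
  ultimately show ?thesis
    by (simp add: star_M[OF assms(1)] alg_simps)
qed

text \<open>Moving each \<open>v i\<close> past x leaves derivatives that add up to the one in
  direction \<open>im_part x\<close>. The hypothesis \<open>hol\<close> is the Cauchy-Riemann
  equation on the slice of x; with it all terms in \<open>f' 1\<close> outside
  \<open>dbar M v f x\<close> cancel. The factor m - 1 arises from + f in the real direction and - f
  in each of the m others, where \<open>v i * (v i * f x) = - f x\<close>.\<close>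

lemma dbar_times_id:
  assumes "openin (top_of_set M) \<Omega>" and f': "(f has_derivative f') (at x within \<Omega>)" and "x \<in> \<Omega>"
    and hol: "f' (im_part x) = im_part x * f' 1"
  shows "2 *\<^sub>R dbar M v (\<lambda>x. x * f x) x = 2 *\<^sub>R (star x * dbar M v f x) - (real m - 1) *\<^sub>R f x"
proof -
  have x: "x \<in> M" using assms openin_imp_subset by blast
  define D where "D = (\<Sum>i = 1..m. v i * f' (v i))"
  note lin = has_derivative_linear[OF f']
  have "((\<lambda>x. x * f x) has_derivative (\<lambda>u. x * f' u + u * f x)) (at x within \<Omega>)"
    by (rule alg.FDERIV[OF has_derivative_ident f'])
  from dbar_eq[OF assms(1) this assms(3)]
  have "2 *\<^sub>R dbar M v (\<lambda>x. x * f x) x =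
      x * f' 1 + f x + (\<Sum>i = 1..m. v i * (x * f' (v i) + v i * f x))"
    by (simp add: one_times)
  also have "(\<Sum>i = 1..m. v i * (x * f' (v i) + v i * f x)) =
      (\<Sum>i = 1..m. star x * (v i * f' (v i)) - 2 *\<^sub>R f' (hc_ip x (v i) *\<^sub>R v i) - f x)"
    using v_in_units
    by (intro sum.cong) (auto simp: alg_simps v_times_times[OF x] imag_unitsD linear_scale[OF lin])
  also have "\<dots> = star x * D - 2 *\<^sub>R f' (im_part x) - real m *\<^sub>R f x"
    by (simp add: D_def im_part_expansion[OF x, symmetric] linear_sum[OF lin] sum_subtractf alg.sum_right
        scaleR_sum_right sum_constant_scaleR)
  also have "star x * D = 2 *\<^sub>R (star x * dbar M v f x) - star x * f' 1"
    using dbar_eq[OF assms(1-3)] by (simp add: D_def algebra_simps flip: alg.scaleR_right)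
        (simp add: alg_simps)
  finally show ?thesis
    using arg_cong[OF re_im_split[of x, symmetric], of "\<lambda>x. x * f' 1"]
    by (simp add: hol star_M[OF x] alg_simps algebra_simps scaleR_2)
qed

end

section \<open>Slice functions are locally slice-regular\<close>

lemma half_eq: "2 *\<^sub>R a = b \<Longrightarrow> a = (1/2) *\<^sub>R (b :: 'b::real_vector)"
  by auto

context hypercomplex_frame begin

text \<open>The trace on \<open>M\<close> of a slice-regular extension: the stem formula for the
  units of \<open>M\<close> at the points of \<open>U\<close>.\<close>

definition local_stem :: "('a \<Rightarrow> 'a) \<Rightarrow> 'a set \<Rightarrow> complex set \<Rightarrow> (complex \<Rightarrow> 'a \<times> 'a) \<Rightarrow> bool"
  where "local_stem f U D F \<longleftrightarrow>
    openin (top_of_set M) U \<and> holomorphic_wrt imath_mult D F \<and>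
    (\<forall>I\<in>units. \<forall>z. slice_emb I z \<in> U \<longrightarrow> z \<in> D \<and> f (slice_emb I z) = fst (F z) + I * snd (F z))"

lemma slice_regular_imp_local_stem:
  assumes "openin (top_of_set M) U" "slice_regular_on (sym_completion U) g" "\<forall>x\<in>U. g x = f x"
  shows "\<exists>D F. local_stem f U D F"
proof -
  obtain D F where D: "cnj ` D = D" "circularization D = sym_completion U"
    and F: "holomorphic_wrt imath_mult D F" "induces D F g"
    using assms(2) unfolding slice_regular_on_def by blast
  have "z \<in> D \<and> f (slice_emb I z) = fst (F z) + I * snd (F z)"
    if I: "I \<in> units" and x: "slice_emb I z \<in> U" for I z
  proof -
    have "slice_emb I z \<in> sphere_of (slice_emb I z)"
      using I by (auto simp: sphere_of_slice_emb)
    then have "slice_emb I z \<in> circularization D" using x D(2) by (auto simp: sym_completion_def)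
    then obtain J w where w: "w \<in> D" "J \<in> imag_units" "slice_emb I z = slice_emb J w"
      by (auto simp: circularization_def)
    then have "w = z \<or> w = cnj z" using slice_emb_eq_iff I by blast
    moreover have "cnj w \<in> D" using w(1) D(1) by blast
    ultimately have "z \<in> D" using w(1) by auto
    then show ?thesis using F(2) I x assms(3) unfolding induces_def by (metis IntD2)
  qed
  then show ?thesis using F(1) assms(1) unfolding local_stem_def by blast
qed

text \<open>The real linear map (a, b) -> a + I * b carries \<open>imath_mult\<close> to left
  multiplication by I, because I * (I * b) = - b.\<close>

lemma local_stem_slice_holomorphic:
  assumes "local_stem f U D F" "I \<in> units" "slice_emb I z \<in> U"
  shows "\<exists>d. ((f \<circ> slice_emb I) has_derivative d) (at z) \<and> (\<forall>h. d (\<i> * h) = I * d h)"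
proof -
  have U: "openin (top_of_set M) U" and F: "holomorphic_wrt imath_mult D F"
    and eq: "slice_emb I w \<in> U \<Longrightarrow> w \<in> D \<and> f (slice_emb I w) = fst (F w) + I * snd (F w)" for w
    using assms(1,2) unfolding local_stem_def by auto
  obtain F' where F': "(F has_derivative F') (at z)" "\<And>h. F' (\<i> * h) = imath_mult (F' h)"
    using F eq assms(3) unfolding holomorphic_wrt_def by blast
  let ?d = "\<lambda>h. fst (F' h) + I * snd (F' h)"
  have "((\<lambda>w. fst (F w) + I * snd (F w)) has_derivative ?d) (at z)"
    by (intro has_derivative_add has_derivative_fst F'(1)
        bounded_linear.has_derivative[OF alg.bounded_linear_right] has_derivative_snd)
  moreover have "open (slice_emb I -` U)"
    using assms(2) slice_emb_in_M
    by (intro open_vimage_frame[OF U] linear_continuous_on bounded_linear_slice_emb) auto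
  ultimately have "((f \<circ> slice_emb I) has_derivative ?d) (at z)"
    by (rule has_derivative_transform_within_open) (use assms(3) eq in auto)
  moreover have "?d (\<i> * h) = I * ?d h" for h
    using assms(2) by (simp add: F'(2) imath_mult_def alg_simps imag_unitsD)
  ultimately show ?thesis by blast
qed

text \<open>Supplies the hypothesis \<open>hol\<close> of \<open>dbar_times_id\<close>: holomorphy
  on the slice compares the directions 1 and I, and linearity scales I by
  \<open>Im z\<close>.\<close>

lemma derivative_im_part:
  assumes "openin (top_of_set M) \<Omega>" and "(f has_derivative f') (at (slice_emb I z) within \<Omega>)"
    and "slice_emb I z \<in> \<Omega>" and I: "I \<in> units"
    and "((f \<circ> slice_emb I) has_derivative d) (at z)" and d: "\<And>h. d (\<i> * h) = I * d h"
  shows "f' (im_part (slice_emb I z)) = im_part (slice_emb I z) * f' 1"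
proof -
  have "((f \<circ> slice_emb I) has_derivative (\<lambda>s. f' (slice_emb I s))) (at z)"
    using assms by (intro has_derivative_slice) auto
  then have "d = (\<lambda>s. f' (slice_emb I s))" using assms(5) has_derivative_unique by blast
  then have "f' I = I * f' 1" using d[of 1] by (simp add: slice_emb_def)
  then show ?thesis
    using I has_derivative_linear[OF assms(2)] by (simp add: slice_emb_parts linear_scale alg_simps)
qed

lemma has_derivative_im_abs:
  assumes "im_abs x > 0"
  shows "(im_abs has_derivative (\<lambda>u. hc_ip (im_part x) (im_part u) / im_abs x)) (at x)"
proof -
  have im: "(im_part has_derivative im_part) (at x)"
    by (rule bounded_linear_imp_has_derivative[OF bounded_linear_im_part])
  have pos: "hc_ip (im_part x) (im_part x) > 0"
    using assms by (simp add: im_abs_def)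
  have ip: "((\<lambda>w. hc_ip (im_part w) (im_part w)) has_derivative
      (\<lambda>u. hc_ip (im_part x) (im_part u) + hc_ip (im_part u) (im_part x))) (at x)"
    by (rule ip.FDERIV[OF im im])
  have eq: "hc_ip (im_part x) (im_part u) + hc_ip (im_part u) (im_part x) =
      2 * hc_ip (im_part x) (im_part u)" for u
    using hc_ip_commute[of "im_part u" "im_part x"] by linarith
  have "((\<lambda>w. hc_ip (im_part w) (im_part w)) has_derivative
      (\<lambda>u. 2 * hc_ip (im_part x) (im_part u))) (at x)"
    using ip unfolding eq .
  from has_derivative_real_sqrt[where g = "\<lambda>w. hc_ip (im_part w) (im_part w)" and x = x, OF pos this]
  have D: "((\<lambda>w. sqrt (hc_ip (im_part w) (im_part w))) has_derivative
      (\<lambda>u. 2 * hc_ip (im_part x) (im_part u) * (inverse (sqrt (hc_ip (im_part x) (im_part x))) / 2))) (at x)" .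
  have e: "2 * hc_ip (im_part x) (im_part u) * (inverse (sqrt (hc_ip (im_part x) (im_part x))) / 2)
    = hc_ip (im_part x) (im_part u) / im_abs x" for u
    unfolding im_abs_def divide_inverse by simp
  have fn: "(\<lambda>w. sqrt (hc_ip (im_part w) (im_part w))) = im_abs"
    by (rule ext) (rule im_abs_def[symmetric])
  from D show ?thesis unfolding e fn .
qed

text \<open>The derivatives of F cancel by its Cauchy-Riemann equations. What remains comes from
  differentiating J = \<open>im_part x\<close> / \<beta>: the m directions \<open>v i\<close> give -
  m / \<beta>, and the derivative of 1 / \<beta> gives back + 1 / \<beta>.\<close>

lemma local_stem_dbar:
  assumes F: "local_stem f U D F" and x: "x \<in> U" and pos: "im_abs x > 0"
  shows "2 *\<^sub>R dbar M v f x = - ((real m - 1) / im_abs x) *\<^sub>R snd (F (zeta x))"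
proof -
  define r where "r = im_abs x"
  define S where "S = snd (F (zeta x))"
  define I where "I = im_part x /\<^sub>R r"
  have U: "openin (top_of_set M) U" and hol: "holomorphic_wrt imath_mult D F"
    and eq: "\<And>I w. I \<in> units \<Longrightarrow> slice_emb I w \<in> U \<Longrightarrow>
      w \<in> D \<and> f (slice_emb I w) = fst (F w) + I * snd (F w)"
    using F unfolding local_stem_def by auto
  have UM: "U \<subseteq> M" and xM: "x \<in> M" using U x openin_imp_subset by blast+
  have r: "r > 0" using pos by (simp add: r_def)
  obtain "I \<in> units" and xI: "x = slice_emb I (zeta x)"
    using M_slice_zeta[OF xM] pos unfolding I_def r_def by metis
  then have II: "I * (I * a) = - a" for a using imag_unitsD by blast
  have im_x: "im_part x = r *\<^sub>R I" using r by (simp add: I_def)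
  have rr: "r * (inverse r * t) = t" for t using r by simp
  have "zeta x \<in> D" using eq[OF \<open>I \<in> units\<close>, of "zeta x"] x xI by simp
  then obtain F' where F': "(F has_derivative F') (at (zeta x))"
    "\<And>h. F' (\<i> * h) = imath_mult (F' h)"
    using hol unfolding holomorphic_wrt_def by blast
  define a where "a u = hc_ip (im_part x) (im_part u) / r" for u
  define Z where "Z u = complex_of_real (re_part u) + \<i> * complex_of_real (a u)" for u
  have da: "(im_abs has_derivative a) (at x)"
    using has_derivative_im_abs[OF pos] by (simp add: a_def[abs_def] r_def)
  have "((\<lambda>w. complex_of_real (re_part w) + \<i> * complex_of_real (im_abs w)) has_derivative Z) (at x)"
    unfolding Z_def[abs_def]
    by (intro has_derivative_add has_derivative_mult_right has_derivative_of_real da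
        bounded_linear_imp_has_derivative[OF bounded_linear_re_part])
  then have dzeta: "(zeta has_derivative Z) (at x)"
    by (simp add: zeta_def[abs_def] Complex_eq)
  have dF: "((\<lambda>w. F (zeta w)) has_derivative (\<lambda>u. F' (Z u))) (at x)"
    by (rule has_derivative_compose[OF dzeta F'(1)])
  \<comment> \<open>The stem formula with its unit expressed by \<open>im_part\<close> and
    \<open>im_abs\<close>. It makes sense around x in the whole algebra, so the ordinary chain and
    product rules apply.\<close>
  define h where "h w = fst (F (zeta w)) + im_part w * (inverse (im_abs w) *\<^sub>R snd (F (zeta w)))" for w
  define h' where "h' u = fst (F' (Z u)) + (im_part x * (inverse r *\<^sub>R snd (F' (Z u))
      + (- (inverse r * a u * inverse r)) *\<^sub>R S) + im_part u * (inverse r *\<^sub>R S))" for u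
  have "(h has_derivative h') (at x)"
    unfolding h_def[abs_def] h'_def[abs_def] r_def S_def
    by (rule has_derivative_add[OF has_derivative_fst[OF dF] alg.FDERIV[OF
        bounded_linear_imp_has_derivative[OF bounded_linear_im_part]
        has_derivative_scaleR[OF Deriv.has_derivative_inverse[OF _ da] has_derivative_snd[OF dF]]]])
       (use pos in simp)
  then have dh: "(h has_derivative h') (at x within U)" by (rule has_derivative_at_withinI)
  have f_h: "h w = f w" if w: "w \<in> U" "im_abs w > 0" for w
  proof -
    have wM: "w \<in> M" using w(1) UM by blast
    obtain J where J: "J \<in> units" "w = slice_emb J (zeta w)" "J = im_part w /\<^sub>R im_abs w"
      using M_slice_zeta[OF wM] w(2) by metis
    have "f w = fst (F (zeta w)) + J * snd (F (zeta w))"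
      using eq[OF J(1), of "zeta w"] J(2) w(1) by metis
    then show ?thesis by (simp add: h_def J(3) alg_simps)
  qed
  have "open {w. im_abs w > 0}"
    by (intro open_Collect_less continuous_on_im_abs continuous_on_const)
  then obtain e where e: "e > 0" "ball x e \<subseteq> {w. im_abs w > 0}"
    using pos openE by blast
  have "(f has_derivative h') (at x within U)"
    by (rule has_derivative_transform_within[OF dh e(1) x])
       (use e(2) f_h in \<open>auto simp: dist_commute subset_iff\<close>)
  from dbar_eq[OF U this x]
  have "2 *\<^sub>R dbar M v f x = h' 1 + (\<Sum>i = 1..m. v i * h' (v i))" .
  also have "h' 1 = fst (F' 1) + I * snd (F' 1)"
    using r by (simp add: h'_def Z_def a_def im_part_def[of 1] ip.zero_right im_x alg_simps alg.zero_left)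
  also have "(\<Sum>i = 1..m. v i * h' (v i)) =
      (\<Sum>i = 1..m. (hc_ip x (v i) *\<^sub>R v i) *
         (inverse r *\<^sub>R (fst (F' \<i>) + I * snd (F' \<i>) - inverse r *\<^sub>R (I * S))) - inverse r *\<^sub>R S)"
  proof (rule sum.cong[OF refl])
    fix i assume i: "i \<in> {1..m}"
    have v: "re_part (v i) = 0" "im_part (v i) = v i" "v i * (v i * b) = - b" for b
      using i v_in_units[of i] imag_unitsD re_part_v[of i] im_part_eq_self by auto
    have "hc_ip (im_part x) (v i) = hc_ip x (v i)"
      using v(1) by (simp add: im_part_def re_part_def ip.diff_left ip.scaleR_left hc_ip_commute[of 1])
    then have a: "a (v i) = hc_ip x (v i) / r" by (simp add: a_def v)
    have Z: "Z (v i) = a (v i) *\<^sub>R \<i>" by (simp add: Z_def v scaleR_conv_of_real)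
    have "F' (Z (v i)) = a (v i) *\<^sub>R F' \<i>"
      unfolding Z by (rule linear_scale[OF has_derivative_linear[OF F'(1)]])
    then show "v i * h' (v i) = (hc_ip x (v i) *\<^sub>R v i) *
         (inverse r *\<^sub>R (fst (F' \<i>) + I * snd (F' \<i>) - inverse r *\<^sub>R (I * S))) - inverse r *\<^sub>R S"
      by (simp add: h'_def v a im_x alg_simps scaleR_add_right scaleR_diff_right divide_inverse mult_ac rr)
  qed
  \<comment> \<open>The coefficients recombine to \<open>im_part x\<close>, which is r times I, and
    the factor r cancels.\<close>
  also have "\<dots> = I * (fst (F' \<i>) + I * snd (F' \<i>) - inverse r *\<^sub>R (I * S)) - (real m * inverse r) *\<^sub>R S"
    using r by (simp only: sum_subtractf alg.sum_left[symmetric] im_part_expansion[OF xM] im_x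
        sum_constant_scaleR) (simp add: alg.scaleR_left alg.scaleR_right)
  finally have *: "2 *\<^sub>R dbar M v f x = fst (F' 1) + I * snd (F' 1) +
      (I * (fst (F' \<i>) + I * snd (F' \<i>) - inverse r *\<^sub>R (I * S)) - (real m * inverse r) *\<^sub>R S)" .
  have "fst (F' \<i>) = - snd (F' 1)" "snd (F' \<i>) = fst (F' 1)"
    using F'(2)[of 1] by (simp_all add: imath_mult_def)
  then have "I * (fst (F' \<i>) + I * snd (F' \<i>) - inverse r *\<^sub>R (I * S)) =
      - (I * snd (F' 1)) - fst (F' 1) + inverse r *\<^sub>R S"
    by (simp add: alg_simps II)
  then show ?thesis
    unfolding * S_def[symmetric] r_def[symmetric]
    by (simp add: divide_inverse algebra_simps)
qed

lemma zeta_sphere_of: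
  assumes "y \<in> M" "w \<in> sphere_of y"
  shows "zeta w = zeta y"
proof -
  obtain J where J: "J \<in> units" "y = slice_emb J (zeta y)" using M_slice_zeta assms(1) by blast
  have "w \<in> sphere_of (slice_emb J (zeta y))" using assms(2) J(2) by metis
  then obtain K where "K \<in> imag_units" "w = slice_emb K (zeta y)"
    using J(1) by (auto simp: sphere_of_slice_emb)
  then show ?thesis using im_abs_nonneg[OF assms(1)] by (simp add: zeta_slice_emb) (simp add: zeta_def)
qed

text \<open>Multiplying F_2 / \<beta> by \<open>star x\<close> = \<alpha> - \<beta> I produces - I *
  F_2, which cancels the only part of \<open>f x\<close> that depends on the unit.\<close>

lemma local_stem_dbar_times:
  assumes F: "local_stem f U D F" and x: "x \<in> U" and pos: "im_abs x > 0"
    and f': "(f has_derivative f') (at x within U)"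
  shows "2 *\<^sub>R dbar M v (\<lambda>x. x * f x) x =
    - (real m - 1) *\<^sub>R (fst (F (zeta x)) + (re_part x / im_abs x) *\<^sub>R snd (F (zeta x)))"
proof -
  have U: "openin (top_of_set M) U" and eq: "\<And>I w. I \<in> units \<Longrightarrow> slice_emb I w \<in> U \<Longrightarrow>
      f (slice_emb I w) = fst (F w) + I * snd (F w)"
    using F unfolding local_stem_def by auto
  have xM: "x \<in> M" using U x openin_imp_subset by blast
  obtain I where I: "I \<in> units" and xI: "x = slice_emb I (zeta x)"
    and im_x: "I = im_part x /\<^sub>R im_abs x"
    using M_slice_zeta[OF xM] pos by metis
  have II: "I * (I * a) = - a" for a using imag_unitsD I by blast
  have im_x: "im_part x = im_abs x *\<^sub>R I" using im_x pos by simp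
  have xI': "slice_emb I (zeta x) \<in> U" using x xI by simp
  obtain d where d: "((f \<circ> slice_emb I) has_derivative d) (at (zeta x))"
    "\<And>h. d (\<i> * h) = I * d h"
    using local_stem_slice_holomorphic[OF F I xI'] by blast
  have "f' (im_part x) = im_part x * f' 1"
    using derivative_im_part[OF U _ xI' I d] f' xI by simp
  from dbar_times_id[OF U f' x this]
  have "2 *\<^sub>R dbar M v (\<lambda>x. x * f x) x = star x * (2 *\<^sub>R dbar M v f x) - (real m - 1) *\<^sub>R f x"
    by (simp add: alg_simps)
  also have "f x = fst (F (zeta x)) + I * snd (F (zeta x))"
    using eq[OF I xI'] xI by simp
  also have "star x = re_part x *\<^sub>R 1 - im_abs x *\<^sub>R I" using star_M[OF xM] im_x by simp
  also note local_stem_dbar[OF F x pos]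
  finally have *: "2 *\<^sub>R dbar M v (\<lambda>x. x * f x) x =
    (re_part x *\<^sub>R 1 - im_abs x *\<^sub>R I) * (- ((real m - 1) / im_abs x) *\<^sub>R snd (F (zeta x)))
    - (real m - 1) *\<^sub>R (fst (F (zeta x)) + I * snd (F (zeta x)))" .
  define c where "c = real m - 1"
  show ?thesis using pos unfolding * c_def[symmetric]
    by (simp add: alg_simps scaleR_add_right scaleR_diff_right)
qed

lemma locally_slice_regularI:
  assumes \<Omega>: "openin (top_of_set M) \<Omega>" and C1: "C1_on \<Omega> f"
    and stem: "\<And>y. y \<in> \<Omega> \<Longrightarrow> \<exists>U D F. y \<in> U \<and> U \<subseteq> \<Omega> \<and> local_stem f U D F"
  shows "locally_slice_regular M v \<Omega> f"
proof -
  have \<Omega>M: "\<Omega> \<subseteq> M" using \<Omega> openin_imp_subset by blast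
  have "holomorphic_wrt (\<lambda>a. I * a) (slice_emb I -` \<Omega>) (f \<circ> slice_emb I)" if "I \<in> units" for I
    unfolding holomorphic_wrt_def
  proof
    fix z assume "z \<in> slice_emb I -` \<Omega>"
    then show "\<exists>d. ((f \<circ> slice_emb I) has_derivative d) (at z) \<and> (\<forall>h. d (\<i> * h) = I * d h)"
      using stem local_stem_slice_holomorphic that by (metis vimageE)
  qed
  moreover have "locally_constant_on (sphere_of y \<inter> \<Omega>) (dbar M v f) \<and>
      locally_constant_on (sphere_of y \<inter> \<Omega>) (dbar M v (\<lambda>x. x * f x))" if y: "y \<in> \<Omega>" for y
  proof -
    have yM: "y \<in> M" using y \<Omega>M by blast
    have "\<exists>V. openin (top_of_set (sphere_of y \<inter> \<Omega>)) V \<and> x \<in> V \<and>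
        dbar M v f constant_on V \<and> dbar M v (\<lambda>x. x * f x) constant_on V"
      if x: "x \<in> sphere_of y \<inter> \<Omega>" for x
    proof -
      obtain U D F where U: "x \<in> U" "U \<subseteq> \<Omega>" and F: "local_stem f U D F" using stem x by blast
      let ?V = "sphere_of y \<inter> \<Omega> \<inter> U"
      have oU: "openin (top_of_set M) U" using F by (simp add: local_stem_def)
      then have "openin (top_of_set (sphere_of y \<inter> \<Omega>)) ?V"
        using \<Omega>M by (auto simp: openin_open)
      moreover have "dbar M v f constant_on ?V \<and> dbar M v (\<lambda>x. x * f x) constant_on ?V"
      proof (cases "im_abs y > 0")
        case True
        have zeta: "zeta w = zeta y" "re_part w = re_part y" "im_abs w = im_abs y" if "w \<in> ?V" for w
          using zeta_sphere_of[OF yM, of w] that by (auto simp: zeta_def)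
        have "2 *\<^sub>R dbar M v f w = - ((real m - 1) / im_abs y) *\<^sub>R snd (F (zeta y))" if "w \<in> ?V" for w
          using local_stem_dbar[OF F, of w] zeta[OF that] that True by auto
        then have "dbar M v f w = (1/2) *\<^sub>R (- ((real m - 1) / im_abs y) *\<^sub>R snd (F (zeta y)))" if "w \<in> ?V" for w
          using half_eq that by blast
        moreover have "2 *\<^sub>R dbar M v (\<lambda>x. x * f x) w =
            - (real m - 1) *\<^sub>R (fst (F (zeta y)) + (re_part y / im_abs y) *\<^sub>R snd (F (zeta y)))"
          if w: "w \<in> ?V" for w
        proof -
          obtain f' where "(f has_derivative f') (at w within \<Omega>)"
            using C1 w by (auto simp: C1_on_def)
          then have "(f has_derivative f') (at w within U)" using U(2) has_derivative_subset by blast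
          then show ?thesis using local_stem_dbar_times[OF F, of w] zeta[OF w] w True by auto
        qed
        then have "dbar M v (\<lambda>x. x * f x) w = (1/2) *\<^sub>R
            (- (real m - 1) *\<^sub>R (fst (F (zeta y)) + (re_part y / im_abs y) *\<^sub>R snd (F (zeta y))))"
          if "w \<in> ?V" for w
          using half_eq that by blast
        ultimately show ?thesis unfolding constant_on_def by blast
      next
        case False
        have "w = y" if "w \<in> ?V" for w
        proof -
          have 0: "Im (zeta y) = 0" using False im_abs_nonneg[OF yM] by (simp add: zeta_def)
          have "w \<in> M" using that \<Omega>M by blast
          then obtain J K where "w = slice_emb J (zeta w)" "y = slice_emb K (zeta y)"
            using M_slice_zeta yM by metis
          moreover have "zeta w = zeta y" using zeta_sphere_of[OF yM] that by blast
          ultimately show ?thesis using 0 by (simp add: slice_emb_def)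
        qed
        then show ?thesis unfolding constant_on_def by metis
      qed
      ultimately show ?thesis using x U(1) by blast
    qed
    then show ?thesis unfolding locally_constant_on_def by meson
  qed
  ultimately show ?thesis using C1 unfolding locally_slice_regular_def by blast
qed

end

section \<open>Stem functions from affine slices\<close>

lemma snd_stem_real:
  assumes "stem_function D F" "z \<in> D" "Im z = 0"
  shows "snd (F z) = 0"
proof -
  have "cnj z = z" using assms(3) by (simp add: complex_eq_iff)
  then have "snd (F z) = - snd (F z)"
    using assms(1,2) by (metis compl_conj_def snd_conv stem_function_def)
  then have "2 *\<^sub>R snd (F z) = 0" by (simp add: scaleR_2 eq_neg_iff_add_eq_0)
  then show ?thesis by simp
qed

text \<open>Slice functions are well defined: the value is the same for (J, z) and (- J,
  \<open>cnj z\<close>) by parity, and on the real axis the second component vanishes. Off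
  \<open>circularization D\<close> the choice operator leaves \<open>g\<close> unspecified.\<close>

lemma stem_function_induces:
  assumes F: "stem_function D (F :: complex \<Rightarrow> 'a \<times> 'a::alternative_star_algebra)"
  shows "\<exists>g. induces D F g"
proof -
  define val where "val p = fst (F (snd p)) + fst p * snd (F (snd p))" for p
  define P where "P x p \<longleftrightarrow> fst p \<in> imag_units \<and> snd p \<in> D \<and> x = slice_emb (fst p) (snd p)" for x :: 'a and p
  have uniq: "val p = val q" if p: "P x p" and q: "P x q" for x p q
  proof -
    have "snd q = snd p \<and> (Im (snd p) = 0 \<or> fst q = fst p) \<or> snd q = cnj (snd p) \<and> fst q = - fst p"
      using p q slice_emb_eq_iff unfolding P_def by metis
    then show ?thesis
    proof (elim disjE conjE)
      assume "snd q = snd p" "Im (snd p) = 0"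
      then show ?thesis using snd_stem_real[OF F, of "snd p"] p
        by (simp add: val_def P_def alg.zero_right)
    next
      assume "snd q = snd p" "fst q = fst p"
      then show ?thesis by (simp add: val_def)
    next
      assume "snd q = cnj (snd p)" "fst q = - fst p"
      moreover have "F (cnj (snd p)) = compl_conj (F (snd p))"
        using F p by (simp add: stem_function_def P_def)
      ultimately show ?thesis by (simp add: val_def compl_conj_def alg_simps)
    qed
  qed
  define g where "g x = val (SOME p. P x p)" for x
  have "g (slice_emb J z) = fst (F z) + J * snd (F z)" if "z \<in> D" "J \<in> imag_units" for z J
  proof -
    have "P (slice_emb J z) (J, z)" using that by (simp add: P_def)
    then have "g (slice_emb J z) = val (J, z)"
      unfolding g_def using uniq someI by metis
    then show ?thesis by (simp add: val_def)
  qed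
  then show ?thesis unfolding induces_def by blast
qed

context hypercomplex_frame begin

text \<open>Separates the distance within a plane from the contribution of the angle between the
  units; the latter disappears when w is real.\<close>

lemma hc_ip_slice_diff:
  assumes I: "I \<in> units" and J: "J \<in> units"
  shows "hc_ip (slice_emb J z - slice_emb I w) (slice_emb J z - slice_emb I w) =
    (cmod (z - w))\<^sup>2 + 2 * Im z * Im w * (1 - hc_ip J I)"
  using I J
  by (simp add: slice_emb_def ip.diff_left ip.diff_right ip.add_left ip.add_right ip.scaleR_left
      ip.scaleR_right hc_ip_imag_unit hc_ip_one hc_ip_commute[of I J] cmod_power2)
    (simp add: power2_eq_square algebra_simps)

lemma diff_square:
  assumes "I \<in> units" "K \<in> units" "K \<noteq> I"
  obtains \<rho> where "\<rho> > 0" "(I - K) * (I - K) = (- \<rho>) *\<^sub>R 1"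
proof
  have M: "I - K \<in> M" "re_part (I - K) = 0"
    using assms units_iff[of I] units_iff[of K] by (auto simp: M_diff re_part_def ip.diff_left)
  show "(I - K) * (I - K) = (- hc_ip (I - K) (I - K)) *\<^sub>R 1"
    using square_pure[OF M] .
  show "hc_ip (I - K) (I - K) > 0"
    using hc_ip_nonneg[OF M(1)] hc_ip_eq_0_iff[OF M(1)] assms(3) by fastforce
qed

text \<open>Subtraction leaves \<open>(I - K) * b = 0\<close>, and \<open>I - K\<close> has a
  nonzero real square. So two units determine an affine function of the unit.\<close>

lemma unit_pair_cancel:
  assumes "I \<in> units" "K \<in> units" "K \<noteq> I" "a + I * b = 0" "a + K * b = 0"
  shows "a = 0" "b = 0"
proof -
  obtain \<rho> where "\<rho> > 0" "(I - K) * (I - K) = (- \<rho>) *\<^sub>R 1" using diff_square assms by metis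
  moreover have "(I - K) * b = 0"
    using assms(4,5) by (simp add: alg_simps) (metis add_left_cancel)
  ultimately show b: "b = 0" using mult_left_cancel_real_square[of "I - K" "- \<rho>" b] by simp
  show "a = 0" using assms(4) by (simp add: b alg.zero_right)
qed

text \<open>The stem function is read off two slices \<open>I\<close>, \<open>K\<close>: as \<open>f\<^sub>I - f\<^sub>K = (I - K) F\<^sub>2\<close> and
  \<open>(I - K)\<^sup>2\<close> is a negative real, \<open>F\<^sub>2\<close> depends on them real linearly.\<close>

lemma stem_of_affine:
  assumes T: "T \<subseteq> units" "I \<in> T" "K \<in> T" "K \<noteq> I"
    and hol: "\<And>J z. J \<in> T \<Longrightarrow> z \<in> W \<Longrightarrow>
      \<exists>d. ((f \<circ> slice_emb J) has_derivative d) (at z) \<and> (\<forall>h. d (\<i> * h) = J * d h)"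
    and aff: "\<And>z. z \<in> W \<Longrightarrow> \<exists>p q. \<forall>J\<in>T. f (slice_emb J z) = p + J * q"
  obtains F where "holomorphic_wrt imath_mult W F"
    "\<And>z J. z \<in> W \<Longrightarrow> J \<in> T \<Longrightarrow> f (slice_emb J z) = fst (F z) + J * snd (F z)"
proof -
  have I: "I \<in> units" and K: "K \<in> units" using T by auto
  define u where "u = I - K"
  obtain \<rho> where \<rho>: "\<rho> > 0" and uu: "u * u = (- \<rho>) *\<^sub>R 1"
    unfolding u_def using diff_square[OF I K T(4)] by metis
  have u2: "u * (u * a) = - (\<rho> *\<^sub>R a)" for a
    using alt_left[of u a] uu by (simp add: alg_simps)
  \<comment> \<open>The inverse of left multiplication by \<open>u\<close>, read off from
    \<open>u2\<close>.\<close>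
  define G where "G w = (- inverse \<rho>) *\<^sub>R (u * w)" for w
  have Gu: "G (u * a) = a" and uG: "u * G a = a" for a
    using \<rho> by (simp_all add: G_def u2 alg_simps)
  have G: "bounded_linear G"
    unfolding G_def[abs_def]
    by (intro bounded_linear_compose[OF bounded_linear_scaleR_right] alg.bounded_linear_right)
  \<comment> \<open>Solves p + I * q = a, p + K * q = b for the pair (p, q).\<close>
  define H where "H a b = (a - I * G (a - b), G (a - b))" for a b
  define F where "F z = H (f (slice_emb I z)) (f (slice_emb K z))" for z
  show ?thesis
  proof
    fix z J assume z: "z \<in> W" and J: "J \<in> T"
    obtain p q where pq: "\<And>J. J \<in> T \<Longrightarrow> f (slice_emb J z) = p + J * q" using aff z by blast
    have "p + I * q - (p + K * q) = u * q" by (simp add: u_def alg_simps)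
    then have "F z = (p, q)" using T by (simp add: F_def H_def pq Gu)
    then show "f (slice_emb J z) = fst (F z) + J * snd (F z)" using pq J by simp
  next
    show "holomorphic_wrt imath_mult W F"
      unfolding holomorphic_wrt_def
    proof
      fix z assume z: "z \<in> W"
      obtain d where d: "((f \<circ> slice_emb I) has_derivative d) (at z)" "\<And>h. d (\<i> * h) = I * d h"
        using hol z T(2) by blast
      obtain e where e: "((f \<circ> slice_emb K) has_derivative e) (at z)" "\<And>h. e (\<i> * h) = K * e h"
        using hol z T(3) by blast
      have dG: "((\<lambda>z. G (f (slice_emb I z) - f (slice_emb K z))) has_derivative (\<lambda>h. G (d h - e h))) (at z)"
        by (rule bounded_linear.has_derivative[OF G has_derivative_diff[OF d(1)[unfolded comp_def] e(1)[unfolded comp_def]]])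
      have "(F has_derivative (\<lambda>h. H (d h) (e h))) (at z)"
        unfolding F_def[abs_def] H_def
        by (rule has_derivative_Pair[OF has_derivative_diff[OF d(1)[unfolded comp_def]
              bounded_linear.has_derivative[OF alg.bounded_linear_right dG]] dG])
      moreover have "H (d (\<i> * h)) (e (\<i> * h)) = imath_mult (H (d h) (e h))" for h
      proof -
        \<comment> \<open>(P, Q) is the derivative of F in direction h, and \<open>d h\<close>,
          \<open>e h\<close> are its values at I and K. Applying I and K respectively gives I * P -
          Q and K * P - Q, which \<open>H\<close> sends to (- Q, P).\<close>
        define Q where "Q = G (d h - e h)"
        define P where "P = d h - I * Q"
        have dh: "d h = P + I * Q" by (simp add: P_def)
        have "e h = d h - u * Q" by (simp add: Q_def uG)
        then have eh: "e h = P + K * Q" by (simp add: dh u_def alg_simps)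
        have "I * d h - K * e h = u * P"
          using I K by (simp add: dh eh u_def alg_simps imag_unitsD)
        then have "G (I * d h - K * e h) = P" by (simp add: Gu)
        then show ?thesis
          using I by (simp add: d(2) e(2) H_def imath_mult_def Q_def[symmetric])
            (simp add: dh alg_simps imag_unitsD)
      qed
      ultimately show "\<exists>F'. (F has_derivative F') (at z) \<and> (\<forall>h. F' (\<i> * h) = imath_mult (F' h))"
        by blast
    qed
  qed
qed

lemma locally_slice_regular_slice:
  assumes "locally_slice_regular M v \<Omega> f" "J \<in> units" "slice_emb J z \<in> \<Omega>"
  shows "\<exists>d. ((f \<circ> slice_emb J) has_derivative d) (at z) \<and> (\<forall>h. d (\<i> * h) = J * d h)"
proof -
  have "slice_emb J z \<in> \<Omega> \<inter> slice_plane J" using assms(3) by (simp add: slice_plane_eq)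
  then have "holomorphic_wrt (\<lambda>a. J * a) (slice_emb J -` \<Omega>) (f \<circ> slice_emb J)"
    using assms(1,2) unfolding locally_slice_regular_def by blast
  then show ?thesis using assms(3) unfolding holomorphic_wrt_def by (metis vimageI)
qed

lemma slice_affine:
  assumes \<Omega>: "openin (top_of_set M) \<Omega>" and lsr: "locally_slice_regular M v \<Omega> f"
    and T: "T \<subseteq> units" "connected T" and z: "\<And>J. J \<in> T \<Longrightarrow> slice_emb J z \<in> \<Omega>"
  shows "\<exists>p q. \<forall>J\<in>T. f (slice_emb J z) = p + J * q"
proof (cases "T = {}")
  case False
  then obtain I where I: "I \<in> T" by blast
  have const: "g (slice_emb J z) = g (slice_emb I z)"
    if g: "locally_constant_on (sphere_of (slice_emb I z) \<inter> \<Omega>) g" and J: "J \<in> T" for g :: "'a \<Rightarrow> 'a" and J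
  proof -
    let ?S = "(\<lambda>J. slice_emb J z) ` T"
    have "connected ?S"
      unfolding slice_emb_def
      by (intro connected_continuous_image T(2) continuous_intros)
    moreover have "\<exists>V. openin (top_of_set ?S) V \<and> x \<in> V \<and> (\<forall>w\<in>V. g w = g x)" if x: "x \<in> ?S" for x
    proof -
      have sub: "?S \<subseteq> sphere_of (slice_emb I z) \<inter> \<Omega>"
      proof -
        have "I \<in> imag_units" using T(1) I by blast
        then show ?thesis using T(1) z by (auto simp: sphere_of_slice_emb)
      qed
      then obtain V where V: "openin (top_of_set (sphere_of (slice_emb I z) \<inter> \<Omega>)) V" "x \<in> V" "g constant_on V"
        using g x unfolding locally_constant_on_def by blast
      have "openin (top_of_set ?S) (?S \<inter> V)"
        using V(1) sub by (auto simp: openin_open)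
      moreover have "\<forall>w\<in>?S \<inter> V. g w = g x" using V(2,3) unfolding constant_on_def by (metis IntD2)
      ultimately show ?thesis using x V(2) by blast
    qed
    ultimately have "g constant_on ?S" by (rule locally_constant_imp_constant)
    then show ?thesis using I J unfolding constant_on_def by (metis imageI)
  qed
  define c where "c = dbar M v f (slice_emb I z)"
  define e where "e = dbar M v (\<lambda>x. x * f x) (slice_emb I z)"
  define k where "k = real m - 1"
  have k: "k > 0" using m_ge_2 by (simp add: k_def)
  \<comment> \<open>These coefficients solve \<open>dbar_times_id\<close> for \<open>f\<close>, with
    c and e the constant values of the two operators and the conjugate written as
    \<open>Re z\<close> - \<open>Im z\<close> J.\<close>
  have "f (slice_emb J z) = (2 / k) *\<^sub>R (Re z *\<^sub>R c - e) + J * ((- 2 * Im z / k) *\<^sub>R c)" if J: "J \<in> T" for J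
  proof -
    have x: "slice_emb J z \<in> \<Omega>" and Ju: "J \<in> units" using z J T(1) by auto
    have xM: "slice_emb J z \<in> M" using Ju slice_emb_in_M by blast
    obtain d where d: "((f \<circ> slice_emb J) has_derivative d) (at z)" "\<And>h. d (\<i> * h) = J * d h"
      using locally_slice_regular_slice[OF lsr Ju x] by blast
    obtain f' where f': "(f has_derivative f') (at (slice_emb J z) within \<Omega>)"
      using lsr x by (auto simp: locally_slice_regular_def C1_on_def)
    note dbar_times_id[OF \<Omega> f' x derivative_im_part[OF \<Omega> f' x Ju d]]
    moreover have "dbar M v f (slice_emb J z) = c" "dbar M v (\<lambda>x. x * f x) (slice_emb J z) = e"
      using const[OF _ J] lsr z[OF I] unfolding c_def e_def locally_slice_regular_def by blast+
    moreover have "star (slice_emb J z) = Re z *\<^sub>R 1 - Im z *\<^sub>R J"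
      using star_M[OF xM] Ju by (simp add: slice_emb_parts)
    ultimately have "2 *\<^sub>R e = 2 *\<^sub>R ((Re z *\<^sub>R 1 - Im z *\<^sub>R J) * c) - k *\<^sub>R f (slice_emb J z)"
      by (simp only: k_def)
    then have "k *\<^sub>R f (slice_emb J z) = 2 *\<^sub>R (Re z *\<^sub>R c - e) - (2 * Im z) *\<^sub>R (J * c)"
      by (simp add: alg_simps algebra_simps)
    then have "inverse k *\<^sub>R (k *\<^sub>R f (slice_emb J z)) =
        inverse k *\<^sub>R (2 *\<^sub>R (Re z *\<^sub>R c - e) - (2 * Im z) *\<^sub>R (J * c))"
      by (rule arg_cong)
    then show ?thesis
      using k by (simp add: alg_simps scaleR_diff_right divide_inverse mult_ac)
  qed
  then show ?thesis by blast
qed simp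

end

section \<open>Local extension\<close>

text \<open>Conjugating before and after \<open>F\<close> preserves holomorphy, as both conjugations
  are antilinear. \<open>W\<close> lies in the open half-plane, so it is disjoint from its mirror
  image and no gluing on the real axis arises.\<close>

lemma holomorphic_wrt_reflect:
  fixes F :: "complex \<Rightarrow> 'a \<times> 'a::real_normed_vector"
  assumes W: "open W" "W \<subseteq> {z. Im z > 0}" and F: "holomorphic_wrt imath_mult W F"
  obtains G where "holomorphic_wrt imath_mult (W \<union> cnj ` W) G" "stem_function (W \<union> cnj ` W) G"
    "\<And>z. z \<in> W \<Longrightarrow> G z = F z"
proof
  define G where "G z = (if Im z > 0 then F z else compl_conj (F (cnj z)))" for z
  show GF: "G z = F z" if "z \<in> W" for z using that W(2) by (auto simp: G_def)
  have Gcnj: "G z = compl_conj (F (cnj z))" if "z \<in> cnj ` W" for z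
    using that W(2) by (auto simp: G_def)
  show "stem_function (W \<union> cnj ` W) G"
    unfolding stem_function_def
  proof
    fix z assume z: "z \<in> W \<union> cnj ` W"
    show "G (cnj z) = compl_conj (G z)"
    proof (cases "z \<in> W")
      case True
      then show ?thesis using GF[of z] Gcnj[of "cnj z"] by simp
    next
      case False
      then have "z \<in> cnj ` W" "cnj z \<in> W" using z by auto
      then show ?thesis using GF[of "cnj z"] Gcnj[of z] by (simp add: compl_conj_def)
    qed
  qed
  have "cnj ` W = cnj -` W" by (force simp: image_iff)
  then have W': "open (cnj ` W)"
    using open_vimage[OF W(1) continuous_on_cnj[OF continuous_on_id]] by simp
  show "holomorphic_wrt imath_mult (W \<union> cnj ` W) G"
    unfolding holomorphic_wrt_def
  proof
    fix z assume "z \<in> W \<union> cnj ` W"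
    then consider "z \<in> W" | "z \<in> cnj ` W" by blast
    then show "\<exists>G'. (G has_derivative G') (at z) \<and> (\<forall>h. G' (\<i> * h) = imath_mult (G' h))"
    proof cases
      case 1
      then obtain F' where F': "(F has_derivative F') (at z)" "\<And>h. F' (\<i> * h) = imath_mult (F' h)"
        using F unfolding holomorphic_wrt_def by blast
      have "(G has_derivative F') (at z)"
        by (rule has_derivative_transform_within_open[OF F'(1) W(1) 1]) (simp add: GF)
      then show ?thesis using F'(2) by blast
    next
      case 2
      then have "cnj z \<in> W" by auto
      then obtain F' where F': "(F has_derivative F') (at (cnj z))" "\<And>h. F' (\<i> * h) = imath_mult (F' h)"
        using F unfolding holomorphic_wrt_def by blast
      have "(cnj has_derivative cnj) (at z)"
        by (rule bounded_linear_imp_has_derivative[OF bounded_linear_cnj])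
      then have d: "((\<lambda>z. F (cnj z)) has_derivative (\<lambda>h. F' (cnj h))) (at z)"
        using F'(1) by (rule has_derivative_compose)
      have "((\<lambda>z. compl_conj (F (cnj z))) has_derivative (\<lambda>h. compl_conj (F' (cnj h)))) (at z)"
        unfolding compl_conj_def
        by (rule has_derivative_Pair[OF has_derivative_fst[OF d] has_derivative_minus[OF has_derivative_snd[OF d]]])
      then have "(G has_derivative (\<lambda>h. compl_conj (F' (cnj h)))) (at z)"
        by (rule has_derivative_transform_within_open[OF _ W' 2]) (simp add: Gcnj)
      moreover have "compl_conj (F' (cnj (\<i> * h))) = imath_mult (compl_conj (F' (cnj h)))" for h
      proof -
        have "F' (cnj (\<i> * h)) = F' (- (\<i> * cnj h))" by simp
        also have "\<dots> = - imath_mult (F' (cnj h))"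
          using linear_neg[OF has_derivative_linear[OF F'(1)]] F'(2) by metis
        finally show ?thesis by (simp add: compl_conj_def imath_mult_def)
      qed
      ultimately show ?thesis by blast
    qed
  qed
qed

text \<open>The completion adds to each point its full sphere, so any one unit of \<open>T\<close>
  already yields all of \<open>circularization D\<close>; points with z in the mirror image of
  \<open>W\<close> are reached by (- K, \<open>cnj z\<close>).\<close>

lemma slice_regular_extension:
  assumes D: "open D" "D = W \<union> cnj ` W" and T: "T \<subseteq> (imag_units :: 'a::alternative_star_algebra set)" "T \<noteq> {}"
    and F: "stem_function D F" "holomorphic_wrt imath_mult D F"
    and f: "\<And>z J. z \<in> W \<Longrightarrow> J \<in> T \<Longrightarrow> f (slice_emb J z) = fst (F z) + J * snd (F z)"
    and U: "U = {slice_emb J z | J z. J \<in> T \<and> z \<in> W}"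
  shows "\<exists>g. slice_regular_on (sym_completion U) g \<and> (\<forall>x\<in>U. g x = f x)"
proof -
  obtain g where g: "induces D F g" using stem_function_induces F(1) by blast
  have sph: "sphere_of (slice_emb J z) = {slice_emb K z | K. K \<in> imag_units}" if "J \<in> T" for J z
    by (rule sphere_of_slice_emb) (use T(1) that in blast)
  have "circularization D = sym_completion U"
  proof (intro equalityI subsetI)
    fix x :: 'a assume "x \<in> circularization D"
    then obtain K z where K: "K \<in> imag_units" "z \<in> D" "x = slice_emb K z"
      by (auto simp: circularization_def)
    obtain J where J: "J \<in> T" using T(2) by blast
    have "\<exists>w\<in>W. x \<in> sphere_of (slice_emb J w)"
    proof (cases "z \<in> W")
      case True
      then show ?thesis using K J by (intro bexI[of _ z]) (auto simp: sph)
    next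
      case False
      then have "cnj z \<in> W" using K(2) D(2) by auto
      moreover have "x = slice_emb (- K) (cnj z)" using K(3) by (simp add: slice_emb_minus)
      then have "x \<in> sphere_of (slice_emb J (cnj z))"
        unfolding sph[OF J] using K(1) imag_units_minus by blast
      ultimately show ?thesis by blast
    qed
    then show "x \<in> sym_completion U" using J U by (auto simp: sym_completion_def)
  next
    fix x :: 'a assume "x \<in> sym_completion U"
    then obtain J z where "J \<in> T" "z \<in> W" "x \<in> sphere_of (slice_emb J z)"
      using U by (auto simp: sym_completion_def)
    then show "x \<in> circularization D"
      using D(2) by (auto simp: sph circularization_def)
  qed
  moreover have "cnj ` D = D" using D(2) by (simp add: image_Un image_image Un_commute)
  ultimately have "slice_regular_on (sym_completion U) g"
    using D(1) F g unfolding slice_regular_on_def by blast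
  moreover have "g x = f x" if "x \<in> U" for x
  proof -
    obtain J z where "J \<in> T" "z \<in> W" "x = slice_emb J z" using \<open>x \<in> U\<close> U by blast
    then show ?thesis using g f T(1) D(2) unfolding induces_def by auto
  qed
  ultimately show ?thesis by blast
qed

section \<open>Connected neighbourhoods of product form and the extension on them\<close>

context hypercomplex_frame begin

text \<open>By \<open>hc_ip_slice_diff\<close> it suffices to bound the planar and the angular term.
  For real w the angular term is zero, so all units are allowed; otherwise J is confined to a cap
  around I.\<close>

lemma slice_neighbourhood:
  assumes \<Omega>: "openin (top_of_set M) \<Omega>" and I: "I \<in> units" and y: "slice_emb I w \<in> \<Omega>" and w: "Im w \<ge> 0"
  obtains r c where "r > 0" "0 \<le> c" "c < 1" "Im w > 0 \<Longrightarrow> r \<le> Im w"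
    "\<And>J z. J \<in> units \<Longrightarrow> z \<in> ball w r \<Longrightarrow> Im w = 0 \<or> hc_ip J I > c \<Longrightarrow> slice_emb J z \<in> \<Omega>"
proof -
  obtain e where e: "e > 0" "\<And>x. x \<in> M \<Longrightarrow> dist x (slice_emb I w) < e \<Longrightarrow> x \<in> \<Omega>"
    using \<Omega> y unfolding openin_euclidean_subtopology_iff by blast
  obtain C where C: "C > 0" "\<And>x. x \<in> M \<Longrightarrow> norm x \<le> C * sqrt (hc_ip x x)"
    using norm_le_hc_norm by blast
  define \<eta> where "\<eta> = e / C"
  have \<eta>: "\<eta> > 0" using e C by (simp add: \<eta>_def)
  have near: "slice_emb J z \<in> \<Omega>"
    if J: "J \<in> units" and lt: "(cmod (z - w))\<^sup>2 + 2 * Im z * Im w * (1 - hc_ip J I) < \<eta>\<^sup>2" for J z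
  proof -
    let ?x = "slice_emb J z - slice_emb I w"
    have "hc_ip ?x ?x < \<eta>\<^sup>2" using hc_ip_slice_diff[OF I J] lt by simp
    then have "sqrt (hc_ip ?x ?x) < \<eta>" using \<eta> by (metis real_sqrt_abs real_sqrt_less_iff abs_of_pos)
    then have "C * sqrt (hc_ip ?x ?x) < e" using C(1) by (simp add: \<eta>_def pos_less_divide_eq mult.commute)
    moreover have "?x \<in> M" using I J by (intro M_diff slice_emb_in_M) auto
    ultimately have "norm ?x < e" using C(2) by fastforce
    then show ?thesis using e(2) J slice_emb_in_M by (auto simp: dist_norm)
  qed
  show ?thesis
  proof (cases "Im w = 0")
    case True
    show ?thesis
    proof (rule that[of \<eta> 0])
      show "\<eta> > 0" by (rule \<eta>)
      fix J z assume "J \<in> units" and z: "z \<in> ball w \<eta>"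
      have "(cmod (z - w))\<^sup>2 < \<eta>\<^sup>2"
        using z by (intro power_strict_mono) (auto simp: dist_norm norm_minus_commute)
      then show "slice_emb J z \<in> \<Omega>" using near[OF \<open>J \<in> units\<close>] True by simp
    qed (use True in auto)
  next
    case False
    then have w: "Im w > 0" using w by simp
    \<comment> \<open>Radius \<open>Im w\<close> forces 0 < \<open>Im z\<close> < 2
      \<open>Im w\<close>; radius \<eta> / 2 bounds the planar term by a quarter of the square of
      \<eta>.\<close>
    define r where "r = min (Im w) (\<eta> / 2)"
    \<comment> \<open>With \<open>Im z\<close> < 2 \<open>Im w\<close> the number 8 bounds the
      angular term by half the square of \<eta>. The truncation at 0 is what
      \<open>connected_cap\<close> requires.\<close>
    define c where "c = max 0 (1 - \<eta>\<^sup>2 / (8 * (Im w)\<^sup>2))"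
    show ?thesis
    proof (rule that[of r c])
      show "r > 0" "0 \<le> c" "c < 1" "r \<le> Im w" using w \<eta> by (auto simp: r_def c_def)
      fix J z assume J: "J \<in> units" and z: "z \<in> ball w r" and "Im w = 0 \<or> hc_ip J I > c"
      then have ip: "1 - hc_ip J I \<le> \<eta>\<^sup>2 / (8 * (Im w)\<^sup>2)" using False by (auto simp: c_def)
      have ip0: "0 \<le> 1 - hc_ip J I" using hc_ip_units_le[OF J I] by simp
      have zr: "cmod (z - w) < r" using z by (simp add: dist_norm norm_minus_commute)
      then have "\<bar>Im z - Im w\<bar> < Im w" using abs_Im_le_cmod[of "z - w"] by (simp add: r_def)
      then have "2 * Im z * Im w * (1 - hc_ip J I) \<le> 2 * (2 * Im w) * Im w * (\<eta>\<^sup>2 / (8 * (Im w)\<^sup>2))"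
        using w ip ip0 by (intro mult_mono) auto
      also have "\<dots> = \<eta>\<^sup>2 / 2" using w by (simp add: power2_eq_square)
      finally have "2 * Im z * Im w * (1 - hc_ip J I) \<le> \<eta>\<^sup>2 / 2" .
      moreover have "(cmod (z - w))\<^sup>2 \<le> (\<eta> / 2)\<^sup>2"
        using zr by (intro power_mono) (auto simp: r_def)
      moreover have "(\<eta> / 2)\<^sup>2 + \<eta>\<^sup>2 / 2 < \<eta>\<^sup>2" using \<eta> by (simp add: power2_eq_square field_simps)
      ultimately show "slice_emb J z \<in> \<Omega>" by (intro near J) simp
    qed
  qed
qed

text \<open>Units that are not antipodal are joined by an arc; antipodal ones are joined through an
  orthogonal unit.\<close>

lemma connected_units: "connected units"
proof -
  have arc: "connected_component units J K" if "J \<in> units" "K \<in> units" "J \<noteq> - K" for J K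
    using units_arc[OF that] unfolding connected_component_def by metis
  have "connected_component units J K" if J: "J \<in> units" and K: "K \<in> units" for J K
  proof (cases "J = - K")
    case True
    obtain L where L: "L \<in> units" "hc_ip L K = 0" using orthogonal_unit[OF K] .
    have "hc_ip K K = 1" using K units_iff by blast
    then have "L \<noteq> - K" "L \<noteq> K" using L(2) by (auto simp: ip.minus_left)
    then have "connected_component units J L" "connected_component units L K"
      using arc[of J L] arc[of L K] J K L(1) True by auto
    then show ?thesis by (rule connected_component_trans)
  qed (use arc J K in blast)
  then show ?thesis by (simp add: connected_iff_connected_component)
qed

text \<open>Each point is joined to the centre I by an arc along which the product with I never
  falls below its initial value.\<close>

lemma connected_cap:
  assumes I: "I \<in> units" and c: "0 \<le> c" "c < 1"
  shows "connected {J \<in> units. hc_ip J I > c}" (is "connected ?T")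
proof -
  have II: "hc_ip I I = 1" using I units_iff by blast
  have arc: "connected_component ?T J I" if J: "J \<in> ?T" for J
  proof -
    have "J \<noteq> - I" using J II c by (auto simp: ip.minus_left)
    then obtain C where "connected C" "J \<in> C" "I \<in> C" "C \<subseteq> units"
      "\<And>L. L \<in> C \<Longrightarrow> hc_ip J I \<ge> 0 \<Longrightarrow> hc_ip L I \<ge> hc_ip J I"
      using units_arc[of J I] J I by blast
    moreover from this have "C \<subseteq> ?T" using J c by fastforce
    ultimately show ?thesis unfolding connected_component_def by blast
  qed
  have "connected_component ?T J K" if "J \<in> ?T" "K \<in> ?T" for J K
    by (rule connected_component_trans[OF arc[OF that(1)] connected_component_sym[OF arc[OF that(2)]]])
  then show ?thesis by (simp add: connected_iff_connected_component)
qed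

lemma locally_slice_regularD:
  assumes \<Omega>: "openin (top_of_set M) \<Omega>" and lsr: "locally_slice_regular M v \<Omega> f" and y: "y \<in> \<Omega>"
  shows "\<exists>U g. openin (top_of_set M) U \<and> y \<in> U \<and> U \<subseteq> \<Omega> \<and>
      slice_regular_on (sym_completion U) g \<and> (\<forall>x\<in>U. g x = f x)"
proof -
  have yM: "y \<in> M" using \<Omega> y openin_imp_subset by blast
  define w where "w = zeta y"
  obtain I where I: "I \<in> units" and yI: "y = slice_emb I w"
    using M_slice_zeta[OF yM] unfolding w_def by blast
  have II: "hc_ip I I = 1" using I units_iff by blast
  have w: "Im w \<ge> 0" using im_abs_nonneg[OF yM] by (simp add: w_def zeta_def)
  obtain r c where r: "r > 0" "Im w > 0 \<Longrightarrow> r \<le> Im w" and c: "0 \<le> c" "c < 1"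
    and nb: "\<And>J z. J \<in> units \<Longrightarrow> z \<in> ball w r \<Longrightarrow> Im w = 0 \<or> hc_ip J I > c \<Longrightarrow> slice_emb J z \<in> \<Omega>"
    using slice_neighbourhood[OF \<Omega> I _ w] y yI by metis
  define W where "W = ball w r"
  have wW: "w \<in> W" and oW: "open W" using r by (simp_all add: W_def)
  have stem: "\<exists>F. holomorphic_wrt imath_mult W F \<and>
      (\<forall>z\<in>W. \<forall>J\<in>T. f (slice_emb J z) = fst (F z) + J * snd (F z))"
    if T: "T \<subseteq> units" "connected T" "I \<in> T" "K \<in> T" "K \<noteq> I"
      and sub: "\<And>J z. J \<in> T \<Longrightarrow> z \<in> W \<Longrightarrow> slice_emb J z \<in> \<Omega>" for T K
  proof -
    have hol: "\<exists>d. ((f \<circ> slice_emb J) has_derivative d) (at z) \<and> (\<forall>h. d (\<i> * h) = J * d h)"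
      if "J \<in> T" "z \<in> W" for J z
      using locally_slice_regular_slice[OF lsr] sub that T(1) by blast
    have aff: "\<exists>p q. \<forall>J\<in>T. f (slice_emb J z) = p + J * q" if "z \<in> W" for z
      using slice_affine[OF \<Omega> lsr T(1,2)] sub that by blast
    show ?thesis using stem_of_affine[OF T(1,3-5) hol aff] by metis
  qed
  show ?thesis
  proof (cases "Im w = 0")
    case True
    have cW: "cnj z \<in> W" if "z \<in> W" for z
    proof -
      have "cnj w = w" using True by (simp add: complex_eq_iff)
      then have "dist w (cnj z) = dist w z" by (metis complex_cnj_diff complex_mod_cnj dist_norm)
      then show ?thesis using that by (simp add: W_def)
    qed
    have sub: "slice_emb J z \<in> \<Omega>" if "J \<in> units" "z \<in> W" for J z
      using nb that True by (simp add: W_def)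
    have mI: "- I \<in> units" using I units_minus by blast
    have neq: "- I \<noteq> I"
    proof
      assume "- I = I"
      then have "hc_ip (- I) I = 1" using II by simp
      then show False using II by (simp add: ip.minus_left)
    qed
    obtain F where F: "holomorphic_wrt imath_mult W F"
      and Ff: "\<And>z J. z \<in> W \<Longrightarrow> J \<in> units \<Longrightarrow> f (slice_emb J z) = fst (F z) + J * snd (F z)"
      using stem[OF order_refl connected_units I mI neq sub] by blast
    have "stem_function W F"
      unfolding stem_function_def
    proof
      fix z assume z: "z \<in> W"
      \<comment> \<open>(J, \<open>cnj z\<close>) and (- J, z) are coordinates of the same point.
        Equating the two formulas for \<open>f\<close> there, for J = I and J = - I, forces the
        parity of F.\<close>
      have eq: "(fst (F (cnj z)) - fst (F z)) + J * (snd (F (cnj z)) + snd (F z)) = 0"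
        if J: "J \<in> units" for J
      proof -
        have "fst (F (cnj z)) + J * snd (F (cnj z)) = f (slice_emb J (cnj z))"
          using Ff cW z J by simp
        also have "\<dots> = f (slice_emb (- J) z)" by (simp add: slice_emb_minus)
        also have "\<dots> = fst (F z) - J * snd (F z)"
          using Ff[OF z iffD2[OF units_minus J]] by (simp add: alg_simps)
        finally show ?thesis by (simp add: alg_simps algebra_simps)
      qed
      have "fst (F (cnj z)) - fst (F z) = 0" "snd (F (cnj z)) + snd (F z) = 0"
        using unit_pair_cancel[OF I mI neq eq[OF I] eq[OF mI]] by blast+
      then show "F (cnj z) = compl_conj (F z)"
        by (simp add: compl_conj_def prod_eq_iff eq_neg_iff_add_eq_0)
    qed
    moreover have "W = W \<union> cnj ` W" using cW by auto
    moreover define U where "U = {slice_emb J z | J z. J \<in> units \<and> z \<in> W}"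
    ultimately obtain g where g: "slice_regular_on (sym_completion U) g" "\<forall>x\<in>U. g x = f x"
      using slice_regular_extension[OF oW, of W units F f U] F Ff I by blast
    have "U = M \<inter> zeta -` W"
    proof (intro equalityI subsetI)
      fix x assume "x \<in> U"
      then obtain J z where x: "J \<in> units" "z \<in> W" "x = slice_emb J z" unfolding U_def by blast
      have "zeta x = z \<or> zeta x = cnj z" using x by (auto simp: zeta_slice_emb complex_eq_iff abs_if)
      then show "x \<in> M \<inter> zeta -` W" using x cW slice_emb_in_M by auto
    next
      fix x assume "x \<in> M \<inter> zeta -` W"
      then show "x \<in> U" using M_slice_zeta[of x] unfolding U_def by blast
    qed
    then have "openin (top_of_set M) U"
      using continuous_openin_preimage_gen[OF continuous_on_zeta oW] by metis
    moreover have "y \<in> U" using yI I wW by (auto simp: U_def)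
    moreover have "U \<subseteq> \<Omega>" using sub by (auto simp: U_def)
    ultimately show ?thesis using g by blast
  next
    case False
    then have w: "Im w > 0" using w by simp
    define T where "T = {J \<in> units. hc_ip J I > c}"
    have T: "T \<subseteq> units" "connected T" "I \<in> T"
      using connected_cap[OF I c] I II c by (auto simp: T_def)
    have sub: "slice_emb J z \<in> \<Omega>" if "J \<in> T" "z \<in> W" for J z
      using nb that by (simp add: W_def T_def)
    have WIm: "W \<subseteq> {z. Im z > 0}"
    proof
      fix z assume "z \<in> W"
      then have "cmod (z - w) < Im w" using r(2)[OF w] by (simp add: W_def dist_norm norm_minus_commute)
      then show "z \<in> {z. Im z > 0}" using abs_Im_le_cmod[of "z - w"] by simp
    qed
    obtain K where K: "K \<in> T" "K \<noteq> I"
    proof -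
      obtain L where L: "L \<in> units" "hc_ip L I = 0" using orthogonal_unit[OF I] .
      \<comment> \<open>The second unit is taken at a prescribed cosine p from I; any p strictly
        between c and 1 stays in the cap and differs from I.\<close>
      define p where "p = (1 + c) / 2"
      have p: "c < p" "p < 1" "0 \<le> p" using c by (auto simp: p_def)
      let ?K = "p *\<^sub>R I + sqrt (1 - p\<^sup>2) *\<^sub>R L"
      have LL: "hc_ip L L = 1" "re_part L = 0" "re_part I = 0" "L \<in> M" "I \<in> M"
        using L(1) I units_iff by blast+
      have p2: "p\<^sup>2 \<le> 1" using p by (simp add: power_le_one)
      have "hc_ip ?K ?K = p\<^sup>2 + (sqrt (1 - p\<^sup>2))\<^sup>2"
        using LL II L(2) by (simp add: ip.add_left ip.add_right ip.scaleR_left ip.scaleR_right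
            hc_ip_commute[of I L] power2_eq_square)
      also have "\<dots> = 1" using p2 by simp
      finally have "?K \<in> units"
        unfolding units_iff using LL by (simp add: M_add M_scale re_part_def ip.add_left ip.scaleR_left)
      moreover have ip: "hc_ip ?K I = p" using II L(2) by (simp add: ip.add_left ip.scaleR_left)
      ultimately have "?K \<in> T" using p by (simp add: T_def)
      moreover have "?K \<noteq> I" using ip II p by (metis less_irrefl)
      ultimately show ?thesis using that by blast
    qed
    obtain F where F: "holomorphic_wrt imath_mult W F"
      and Ff: "\<And>z J. z \<in> W \<Longrightarrow> J \<in> T \<Longrightarrow> f (slice_emb J z) = fst (F z) + J * snd (F z)"
      using stem[OF T K sub] by blast
    obtain G where G: "holomorphic_wrt imath_mult (W \<union> cnj ` W) G" "stem_function (W \<union> cnj ` W) G"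
      "\<And>z. z \<in> W \<Longrightarrow> G z = F z"
      using holomorphic_wrt_reflect[OF oW WIm F] by metis
    define U where "U = {slice_emb J z | J z. J \<in> T \<and> z \<in> W}"
    have "cnj ` W = cnj -` W" by (force simp: image_iff)
    then have "open (W \<union> cnj ` W)"
      using oW open_vimage[OF oW continuous_on_cnj[OF continuous_on_id]] by (simp add: open_Un)
    then obtain g where g: "slice_regular_on (sym_completion U) g" "\<forall>x\<in>U. g x = f x"
      using slice_regular_extension[of "W \<union> cnj ` W" W T G f U] G Ff T U_def by auto
    \<comment> \<open>The cap condition multiplied by \<open>im_abs x\<close>: it is then a strict
      inequality between continuous functions on the whole space, also where the unit of x is
      undefined.\<close>
    let ?P = "{x. hc_ip (im_part x) I > c * im_abs x}"
    have "U = M \<inter> zeta -` W \<inter> (M \<inter> ?P)"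
    proof (intro equalityI subsetI)
      fix x assume "x \<in> U"
      then obtain J z where x: "J \<in> T" "z \<in> W" "x = slice_emb J z" unfolding U_def by blast
      have z: "Im z > 0" using x(2) WIm by auto
      have J: "J \<in> units" "hc_ip J I > c" using x(1) by (auto simp: T_def)
      have "zeta x = z" using z J x by (simp add: zeta_slice_emb)
      moreover have "x \<in> ?P" using z J x by (simp add: slice_emb_parts ip.scaleR_left mult.commute)
      ultimately show "x \<in> M \<inter> zeta -` W \<inter> (M \<inter> ?P)" using x J slice_emb_in_M by auto
    next
      fix x assume x: "x \<in> M \<inter> zeta -` W \<inter> (M \<inter> ?P)"
      then have xM: "x \<in> M" and "zeta x \<in> W" by auto
      then have pos: "im_abs x > 0" using WIm by (auto simp: zeta_def)
      obtain J where J: "J \<in> units" "x = slice_emb J (zeta x)" "J = im_part x /\<^sub>R im_abs x"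
        using M_slice_zeta[OF xM] pos by metis
      have "hc_ip J I > c" using x pos unfolding J(3) by (simp add: ip.scaleR_left field_simps)
      then have "J \<in> T" using J(1) by (simp add: T_def)
      then show "x \<in> U" using J(2) \<open>zeta x \<in> W\<close> unfolding U_def by blast
    qed
    moreover have "openin (top_of_set M) (M \<inter> zeta -` W)"
      by (rule continuous_openin_preimage_gen[OF continuous_on_zeta oW])
    moreover have "open ?P"
      by (intro open_Collect_less continuous_intros continuous_on_im_abs ip.continuous_on
          bounded_linear.continuous_on[OF bounded_linear_im_part])
    ultimately have "openin (top_of_set M) U" by (simp add: openin_Int openin_open_Int)
    moreover have "y \<in> U" using yI T(3) wW by (auto simp: U_def)
    moreover have "U \<subseteq> \<Omega>" using sub by (auto simp: U_def)
    ultimately show ?thesis using g by blast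
  qed
qed

end

theorem theorem19:
  fixes M \<Omega> :: "'a::alternative_star_algebra set"
    and v :: "nat \<Rightarrow> 'a" and f :: "'a \<Rightarrow> 'a"
  assumes "(imag_units :: 'a set) \<noteq> {}"
    and "hypercomplex_subspace M"
    and "hc_orthonormal_basis M v"
    and "openin (top_of_set M) \<Omega>"
    and "C1_on \<Omega> f"
    and "\<not> (\<forall>x y z :: 'a. (x * y) * z = x * (y * z)) \<longrightarrow>
           admissible M v \<Omega> f \<and> admissible M v \<Omega> (\<lambda>x. x * f x)"
  shows "locally_slice_regular M v \<Omega> f \<longleftrightarrow>
    (\<forall>y\<in>\<Omega>. \<exists>U g. openin (top_of_set M) U \<and> y \<in> U \<and> U \<subseteq> \<Omega> \<and>
       slice_regular_on (sym_completion U) g \<and> (\<forall>x\<in>U. g x = f x))"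
proof -
  interpret hypercomplex_frame M v by standard (fact assms(2,3))+
  show ?thesis
  proof
    show "\<forall>y\<in>\<Omega>. \<exists>U g. openin (top_of_set M) U \<and> y \<in> U \<and> U \<subseteq> \<Omega> \<and>
       slice_regular_on (sym_completion U) g \<and> (\<forall>x\<in>U. g x = f x)"
      if "locally_slice_regular M v \<Omega> f"
      using locally_slice_regularD[OF assms(4) that] by blast
    show "locally_slice_regular M v \<Omega> f"
      if ext: "\<forall>y\<in>\<Omega>. \<exists>U g. openin (top_of_set M) U \<and> y \<in> U \<and> U \<subseteq> \<Omega> \<and>
       slice_regular_on (sym_completion U) g \<and> (\<forall>x\<in>U. g x = f x)"
    proof (rule locally_slice_regularI[OF assms(4,5)])
      fix y assume "y \<in> \<Omega>"
      then obtain U g where U: "openin (top_of_set M) U" "y \<in> U" "U \<subseteq> \<Omega>"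
        "slice_regular_on (sym_completion U) g" "\<forall>x\<in>U. g x = f x"
        using ext by blast
      then obtain D F where "local_stem f U D F"
        using slice_regular_imp_local_stem[OF U(1,4,5)] by blast
      then show "\<exists>U D F. y \<in> U \<and> U \<subseteq> \<Omega> \<and> local_stem f U D F"
        using U(2,3) by blast
    qed
  qed
qed

end
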